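(* Let $Q_0\subset\mathbb{R}^n$ be a cube. Let $f_k\in\mathrm{BMO}(Q_0)$ for $k\in\mathbb{N}$ and let $f\in\mathrm{VMO}(Q_0)$. Suppose that $f_k\to f$ in $\mathrm{BMO}(Q_0)$ (that is, $\|f_k-f\|_{\mathrm{BMO}}\to0$) and that the means $\frac{1}{|Q_0|}\int_{Q_0}f_k$ converge to $\frac{1}{|Q_0|}\int_{Q_0}f$. Then $f_k^*\to f^*$ in $\mathrm{BMO}(0,|Q_0|)$, i.e. $\|f_k^*-f^*\|_{\mathrm{BMO}}\to 0$.
   Context: Cubes are open, of finite side length, with sides parallel to the coordinate axes; $|\cdot|$ is Lebesgue measure. For a set $S$ with $0<|S|<\infty$ and real-valued $f\in L^1(S)$, put $f_S=\frac1{|S|}\int_S f$ and $\mathcal{O}(f,S)=\frac1{|S|}\int_S|f-f_S|$ (mean oscillation). $\mathrm{BMO}(Q_0)$ is the set of real-valued $f$ with $f\in L^1(Q)$ for every cube $Q\subset Q_0$ (including $Q=Q_0$) and $\|f\|_{\mathrm{BMO}}:=\sup_{Q\subset Q_0}\mathcal{O}(f,Q)<\infty$ (a seminorm). $\mathrm{VMO}(Q_0)$ is the set of $f\in\mathrm{BMO}(Q_0)$ with $\lim_{\delta\to0^+}\sup\{\mathcal{O}(f,Q): Q\subset Q_0 \text{ a cube},\ |Q|\le\delta\}=0$. For an open interval $I\subset\mathbb{R}$, $\mathrm{BMO}(I)$ and its seminorm are defined in the same way using all finite open subintervals $J\subset I$ (not required to be compactly contained in $I$) in place of cubes. For a measurable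 function $f$ on $Q_0$, the distribution function is $\mu_f(\alpha)=|\{x\in Q_0:|f(x)|>\alpha\}|$, $\alpha\ge0$, and the decreasing rearrangement is $f^*(s)=|\{\alpha\ge0:\mu_f(\alpha)>s\}|$ for $s\in(0,|Q_0|)$. (Functions are not identified modulo constants.) *)

theory Defs
  imports "HOL-Analysis.Analysis"
begin

definition is_cube :: "'a::euclidean_space set \<Rightarrow> bool" where
  "is_cube Q \<longleftrightarrow> (\<exists>a r. r > 0 \<and> Q = box a (a + r *\<^sub>R One))"

lemma is_cube_cart:
  "is_cube (Q :: (real ^ 'n) set) \<longleftrightarrow>
     (\<exists>a r. r > 0 \<and> Q = {x. \<forall>i. a $ i < x $ i \<and> x $ i < a $ i + r})"
proof -
  have "(One :: real ^ 'n) $ i = 1" for i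
    by (metis axis_in_Basis_iff Basis_real_def cart_eq_inner_axis inner_commute inner_sum_Basis singletonI)
  then show ?thesis
    by (simp add: is_cube_def set_eq_iff mem_box_cart)
qed

text \<open>In dimension one the cubes are exactly the nonempty bounded open intervals, so the
  definitions below also give \<open>BMO(I)\<close> for an open interval \<open>I\<close> of reals.\<close>

lemma is_cube_real: "is_cube (J :: real set) \<longleftrightarrow> (\<exists>a b. a < b \<and> J = {a<..<b})"
proof -
  have "(\<exists>a r. r > 0 \<and> J = {a<..<a + r}) \<longleftrightarrow> (\<exists>a b. a < b \<and> J = {a<..<b})"
    by (metis add.commute diff_add_cancel diff_gt_0_iff_gt less_add_same_cancel1)
  then show ?thesis
    by (simp add: is_cube_def box_real)
qed

definition subcubes :: "'a::euclidean_space set \<Rightarrow> 'a set set" where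
  "subcubes \<Omega> = {Q. is_cube Q \<and> Q \<subseteq> \<Omega>}"

definition avg :: "('a::euclidean_space \<Rightarrow> real) \<Rightarrow> 'a set \<Rightarrow> real" where
  "avg f S = (LINT x:S|lebesgue. f x) / measure lebesgue S"

definition mean_osc :: "('a::euclidean_space \<Rightarrow> real) \<Rightarrow> 'a set \<Rightarrow> real" where
  "mean_osc f S = (LINT x:S|lebesgue. \<bar>f x - avg f S\<bar>) / measure lebesgue S"

text \<open>Functions are total, but only their values on \<open>\<Omega>\<close> enter the notions below. The seminorm
  is extended-valued; since the Lebesgue integral of a non-integrable function is zero, its value
  is meaningful only for functions integrable on every subcube.\<close>

definition bmo_seminorm :: "'a::euclidean_space set \<Rightarrow> ('a \<Rightarrow> real) \<Rightarrow> ennreal" where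
  "bmo_seminorm \<Omega> f = (SUP Q\<in>subcubes \<Omega>. ennreal (mean_osc f Q))"

definition BMO :: "'a::euclidean_space set \<Rightarrow> ('a \<Rightarrow> real) set" where
  "BMO \<Omega> = {f. (\<forall>Q\<in>subcubes \<Omega>. f absolutely_integrable_on Q) \<and> bmo_seminorm \<Omega> f < \<infinity>}"

definition VMO :: "'a::euclidean_space set \<Rightarrow> ('a \<Rightarrow> real) set" where
  "VMO \<Omega> = {f \<in> BMO \<Omega>.
     ((\<lambda>\<delta>. SUP Q\<in>{Q \<in> subcubes \<Omega>. measure lebesgue Q \<le> \<delta>}. ennreal (mean_osc f Q))
        \<longlongrightarrow> 0) (at_right (0::real))}"

definition distr_fun :: "'a::euclidean_space set \<Rightarrow> ('a \<Rightarrow> real) \<Rightarrow> real \<Rightarrow> real" where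
  "distr_fun \<Omega> f \<alpha> = measure lebesgue {x \<in> \<Omega>. \<bar>f x\<bar> > \<alpha>}"

text \<open>For measurable \<open>f\<close> on a set \<open>\<Omega>\<close> of finite measure, \<open>distr_fun \<Omega> f\<close> is decreasing with
  limit \<open>0\<close>, so for \<open>s > 0\<close> the set of levels below is a bounded interval and the real-valued
  measure loses nothing.\<close>

definition decr_rearr :: "'a::euclidean_space set \<Rightarrow> ('a \<Rightarrow> real) \<Rightarrow> real \<Rightarrow> real" where
  "decr_rearr \<Omega> f s = measure lebesgue {\<alpha>. \<alpha> \<ge> 0 \<and> distr_fun \<Omega> f \<alpha> > s}"

end

theory Submission
  imports Defs "HOL-Real_Asymp.Real_Asymp"
begin

text \<open>
  Let \<open>n\<close> be the dimension and write \<open>f\<^sup>*\<close> for the decreasing rearrangement. Everything rests on a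
  local estimate: if \<open>f\<close> has mean oscillation at most \<open>\<epsilon>\<close> on all cubes of measure at most \<open>q\<close>, then
  \<open>f\<^sup>*\<close> has mean oscillation at most \<open>C \<epsilon>\<close> on all intervals \<open>(a, b)\<close> of length at most \<open>q / 8\<close>, where
  \<open>C\<close> depends on \<open>n\<close> only. Cut \<open>Q\<^sub>0\<close> into dyadic cubes of measure \<open>q\<close> and consider
  the level set \<open>G = {\<bar>f\<bar> > f\<^sup>*(b)}\<close>. If \<open>G\<close> fills at most half of each small cube, a
  Calderon-Zygmund decomposition of \<open>G\<close> inside the small cubes bounds the integral of
  \<open>f\<^sup>* - f\<^sup>*(b)\<close> over \<open>(0, b)\<close> by \<open>C \<epsilon> b\<close>; if \<open>G\<close> fills at least half of each of them, the same
  applies to \<open>- \<bar>f\<bar>\<close> and \<open>(a, \<bar>Q\<^sub>0\<bar>)\<close>; otherwise some translate of a small cube meets \<open>G\<close> in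
  exactly half its measure, and there the oscillation of \<open>f\<close> controls \<open>f\<^sup>*(a) - f\<^sup>*(b)\<close> directly.

  Since \<open>f\<close> is in VMO, the estimate holds with small \<open>\<epsilon>\<close> for \<open>f\<close> and for \<open>f\<^sub>k\<close> with \<open>k\<close>
  large, on the same scale \<open>q\<close>, which handles short intervals. On long intervals the
  oscillation of \<open>f\<^sub>k\<^sup>* - f\<^sup>*\<close> is bounded by its \<open>L\<^sup>1\<close> norm, hence by that of \<open>f\<^sub>k - f\<close>.
\<close>

section \<open>Dyadic cubes\<close>

lemma measure_cube: "r > 0 \<Longrightarrow> measure lebesgue (box a (a + r *\<^sub>R (One::'a::euclidean_space))) = r ^ DIM('a)"
  by (simp add: measure_lborel_box_eq inner_add_left)

lemma is_cube_lmeasurable [intro]: "is_cube Q \<Longrightarrow> Q \<in> lmeasurable"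
  by (auto simp: is_cube_def)

lemma is_cube_measure_pos: "is_cube Q \<Longrightarrow> measure lebesgue Q > 0"
  unfolding is_cube_def using measure_cube by (metis zero_less_power)

text \<open>At level \<open>m\<close> a point is labelled by the integer parts of its rescaled
  coordinates, and the open dyadic cubes with the labels that occur in \<open>Q\<close> are kept.
  Since they are open, a point may miss the cube with its own label, but then it lies on one of
  finitely many frontiers; this is why each level covers \<open>Q\<close> only up to a null
  set.\<close>

lemma dyadic_grid:
  fixes Q :: "'a::euclidean_space set"
  assumes "is_cube Q"
  obtains D :: "nat \<Rightarrow> 'a set set" and r :: real where
    "D 0 = {Q}" "\<And>m. finite (D m)" "\<And>m. disjoint (D m)" "\<And>m. negligible (Q - \<Union>(D m))"
    "\<And>m K. K \<in> D m \<Longrightarrow> K \<in> subcubes Q"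
    "\<And>m K. K \<in> D m \<Longrightarrow> measure lebesgue K * 2 ^ (DIM('a) * m) = measure lebesgue Q"
    "\<And>m K. K \<in> D m \<Longrightarrow> \<exists>y. K = box y (y + (r / 2 ^ m) *\<^sub>R One)"
    "r > 0"
    "\<And>m K. K \<in> D (Suc m) \<Longrightarrow> \<exists>K'\<in>D m. K \<subseteq> K'"
    "\<And>m K x y. K \<in> D m \<Longrightarrow> x \<in> K \<Longrightarrow> y \<in> K \<Longrightarrow> dist x y \<le> real DIM('a) * r / 2 ^ m"
proof -
  obtain a r where r: "r > 0" and Q: "Q = box a (a + r *\<^sub>R One)"
    using assms by (auto simp: is_cube_def)
  define fl where "fl m x i = \<lfloor>((x - a) \<bullet> i) * 2 ^ m / r\<rfloor>" for m :: nat and x i :: 'a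
  define c where "c m k = a + (\<Sum>i\<in>Basis. (r / 2 ^ m * real_of_int (k i)) *\<^sub>R i)" for m :: nat and k :: "'a \<Rightarrow> int"
  define B where "B m k = box (c m k) (c m k + (r / 2 ^ m) *\<^sub>R One)" for m :: nat and k :: "'a \<Rightarrow> int"
  define D where "D m = (\<lambda>x. B m (fl m x)) ` Q" for m
  have c_inner: "c m k \<bullet> i = a \<bullet> i + r / 2 ^ m * real_of_int (k i)" if "i \<in> Basis" for m k i
    using that by (simp add: c_def inner_add_left)
  have B_iff: "y \<in> B m k \<longleftrightarrow> (\<forall>i\<in>Basis. of_int (k i) < ((y - a) \<bullet> i) * 2 ^ m / r \<and> ((y - a) \<bullet> i) * 2 ^ m / r < of_int (k i) + 1)" for y m k
    unfolding B_def mem_box using r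
    by (auto simp: c_inner inner_add_left inner_diff_left field_simps)
  have cB_iff: "y \<in> closure (B m k) \<longleftrightarrow> (\<forall>i\<in>Basis. of_int (k i) \<le> ((y - a) \<bullet> i) * 2 ^ m / r \<and> ((y - a) \<bullet> i) * 2 ^ m / r \<le> of_int (k i) + 1)" for y m k
  proof -
    have "box (c m k) (c m k + (r / 2 ^ m) *\<^sub>R One) \<noteq> {}"
      using r by (auto simp: box_eq_empty inner_add_left not_le)
    then show ?thesis
    unfolding B_def mem_box using r
    by (auto simp: mem_box c_inner inner_add_left inner_diff_left field_simps)
  qed
  have fl_eq: "fl m y i = k i" if "y \<in> B m k" "i \<in> Basis" for y m k i
    using that unfolding B_iff fl_def by (intro floor_unique) (auto intro: less_imp_le)
  have B_cong: "B m k = B m k'" if "\<And>i. i \<in> Basis \<Longrightarrow> k i = k' i" for m k k'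
    using that by (auto simp: B_iff)
  have Q_iff: "y \<in> Q \<longleftrightarrow> (\<forall>i\<in>Basis. 0 < (y - a) \<bullet> i / r \<and> (y - a) \<bullet> i / r < 1)" for y
    unfolding Q mem_box using r by (auto simp: inner_add_left inner_diff_left field_simps)
  have fl_bounds: "0 \<le> fl m x i" "fl m x i < 2 ^ m" if "x \<in> Q" "i \<in> Basis" for x m i
  proof -
    have "0 < (x - a) \<bullet> i / r" "(x - a) \<bullet> i / r < 1" using that Q_iff by auto
    then have "0 \<le> (x - a) \<bullet> i * 2 ^ m / r" "(x - a) \<bullet> i * 2 ^ m / r < 2 ^ m"
      using r by (auto simp: field_simps)
    then show "0 \<le> fl m x i" "fl m x i < 2 ^ m" by (auto simp: fl_def floor_less_iff)
  qed
  have BQ: "B m (fl m x) \<subseteq> Q" if "x \<in> Q" for m x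
  proof
    fix y assume y: "y \<in> B m (fl m x)"
    show "y \<in> Q" unfolding Q_iff
    proof
      fix i :: 'a assume i: "i \<in> Basis"
      have "0 \<le> real_of_int (fl m x i)" "real_of_int (fl m x i) + 1 \<le> 2 ^ m"
        using fl_bounds[OF that i, of m] int_less_real_le[of "fl m x i" "2 ^ m"] by simp_all
      moreover have "of_int (fl m x i) < ((y - a) \<bullet> i) * 2 ^ m / r" "((y - a) \<bullet> i) * 2 ^ m / r < of_int (fl m x i) + 1"
        using y i B_iff by auto
      ultimately have "0 < ((y - a) \<bullet> i) * 2 ^ m / r" "((y - a) \<bullet> i) * 2 ^ m / r < 2 ^ m" by linarith+
      then show "0 < (y - a) \<bullet> i / r \<and> (y - a) \<bullet> i / r < 1" using r by (auto simp: field_simps zero_less_mult_iff)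
    qed
  qed
  have cube: "is_cube (B m k)" for m k
    unfolding is_cube_def B_def using r by (intro exI[of _ "c m k"] exI[of _ "r / 2 ^ m"]) auto
  show thesis
  proof
    show "r > 0" by fact
    show "D 0 = {Q}"
    proof -
      have "B 0 (fl 0 x) = Q" if "x \<in> Q" for x
      proof -
        have "fl 0 x i = 0" if "i \<in> Basis" for i using fl_bounds[OF \<open>x \<in> Q\<close> that, of 0] by auto
        then have "B 0 (fl 0 x) = B 0 (\<lambda>_. 0)" by (intro B_cong) auto
        also have "\<dots> = Q" by (auto simp: B_iff Q_iff)
        finally show ?thesis .
      qed
      moreover have "Q \<noteq> {}" using r by (auto simp: Q box_eq_empty inner_add_left not_le)
      ultimately show ?thesis unfolding D_def by auto
    qed
    show fin: "finite (D m)" for m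
    proof (rule finite_subset)
      show "D m \<subseteq> B m ` (Basis \<rightarrow>\<^sub>E {0..<2 ^ m})"
      proof
        fix K assume "K \<in> D m"
        then obtain x where x: "x \<in> Q" "K = B m (fl m x)" by (auto simp: D_def)
        \<comment> \<open>A label is a function on the whole type of which only the values on
          \<open>Basis\<close> matter; restricting it gives a finite index set.\<close>
        have "K = B m (restrict (fl m x) Basis)" unfolding x by (rule B_cong) auto
        moreover have "restrict (fl m x) Basis \<in> Basis \<rightarrow>\<^sub>E {0..<2 ^ m}" using fl_bounds[OF x(1)] by auto
        ultimately show "K \<in> B m ` (Basis \<rightarrow>\<^sub>E {0..<2 ^ m})" by blast
      qed
    qed (auto intro!: finite_PiE)
    show "disjoint (D m)" for m
    proof (rule disjointI)
      fix K K' assume "K \<in> D m" "K' \<in> D m" "K \<noteq> K'"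
      then obtain x x' where K: "K = B m (fl m x)" "K' = B m (fl m x')" by (auto simp: D_def)
      show "K \<inter> K' = {}"
      proof (rule ccontr)
        assume "K \<inter> K' \<noteq> {}"
        then obtain y where "y \<in> K" "y \<in> K'" by auto
        then have "fl m x i = fl m x' i" if "i \<in> Basis" for i
          using fl_eq[of y m _ i] K that by metis
        then show False using \<open>K \<noteq> K'\<close> K B_cong by metis
      qed
    qed
    show "negligible (Q - \<Union>(D m))" for m
    proof (rule negligible_subset)
      show "negligible (\<Union>K\<in>D m. frontier K)"
        using fin[of m] by (intro negligible_Union) (auto simp: D_def B_def negligible_convex_frontier)
      show "Q - \<Union>(D m) \<subseteq> (\<Union>K\<in>D m. frontier K)"
      proof
        fix y assume y: "y \<in> Q - \<Union>(D m)"
        then have K: "B m (fl m y) \<in> D m" "y \<notin> B m (fl m y)" by (auto simp: D_def)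
        have "y \<in> closure (B m (fl m y))" unfolding cB_iff fl_def by (auto intro: less_imp_le)
        then have "y \<in> frontier (B m (fl m y))" using K(2)
          unfolding frontier_def B_def by (simp add: interior_open open_box)
        then show "y \<in> (\<Union>K\<in>D m. frontier K)" using K(1) by blast
      qed
    qed
    fix m K assume K: "K \<in> D m"
    show "K \<in> subcubes Q" using K cube BQ unfolding D_def subcubes_def by blast
    have "measure lebesgue K = (r / 2 ^ m) ^ DIM('a)" using K r measure_cube[of "r / 2 ^ m"] unfolding D_def B_def by auto
    then show "measure lebesgue K * 2 ^ (DIM('a) * m) = measure lebesgue Q"
      using r measure_cube[OF r, of a] by (simp add: Q power_divide power_mult mult.commute)
    show "\<exists>y. K = box y (y + (r / 2 ^ m) *\<^sub>R One)" using K by (auto simp: D_def B_def)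
    fix x y assume xy: "x \<in> K" "y \<in> K"
    obtain z where z: "K = box z (z + (r / 2 ^ m) *\<^sub>R One)" using K by (auto simp: D_def B_def)
    have "dist x y \<le> (\<Sum>i\<in>Basis. \<bar>(x - y) \<bullet> i\<bar>)" unfolding dist_norm by (rule norm_le_l1)
    also have "\<dots> \<le> (\<Sum>i\<in>(Basis::'a set). r / 2 ^ m)"
      using xy unfolding z mem_box by (intro sum_mono) (force simp: inner_add_left inner_diff_left abs_le_iff)
    finally show "dist x y \<le> real DIM('a) * r / 2 ^ m" by simp
  next
    fix m K assume "K \<in> D (Suc m)"
    then obtain x where x: "x \<in> Q" "K = B (Suc m) (fl (Suc m) x)" by (auto simp: D_def)
    have "K \<subseteq> B m (fl m x)"
    proof
      fix y assume y: "y \<in> K"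
      show "y \<in> B m (fl m x)" unfolding B_iff
      proof
        fix i :: 'a assume i: "i \<in> Basis"
        define t where "t = ((y - a) \<bullet> i) * 2 ^ m / r"
        define u where "u = ((x - a) \<bullet> i) * 2 ^ m / r"
        have "of_int \<lfloor>2 * u\<rfloor> < 2 * t" "2 * t < of_int \<lfloor>2 * u\<rfloor> + 1"
          using y i unfolding x B_iff t_def u_def fl_def by (auto simp: mult_ac)
        \<comment> \<open>The label of a child is twice that of its parent plus 0 or 1, so in each
          coordinate the child occupies one half of the parent.\<close>
        moreover have "2 * \<lfloor>u\<rfloor> \<le> \<lfloor>2 * u\<rfloor>" "\<lfloor>2 * u\<rfloor> \<le> 2 * \<lfloor>u\<rfloor> + 1" by linarith+
        ultimately have "of_int \<lfloor>u\<rfloor> < t \<and> t < of_int \<lfloor>u\<rfloor> + 1" by linarith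
        then show "of_int (fl m x i) < ((y - a) \<bullet> i) * 2 ^ m / r \<and> ((y - a) \<bullet> i) * 2 ^ m / r < of_int (fl m x i) + 1"
          by (simp add: t_def u_def fl_def)
      qed
    qed
    then show "\<exists>K'\<in>D m. K \<subseteq> K'" using x by (auto simp: D_def)
  qed
qed

section \<open>Calderon-Zygmund decomposition\<close>

lemma set_integral_ae_partition:
  fixes h :: "'a::euclidean_space \<Rightarrow> real"
  assumes C: "finite C" "disjoint C" "\<And>K. K \<in> C \<Longrightarrow> K \<in> sets lebesgue" "\<And>K. K \<in> C \<Longrightarrow> K \<subseteq> S"
    and neg: "negligible (S - \<Union>C)" and S: "S \<in> sets lebesgue" and h: "set_integrable lebesgue S h"
  shows "(LINT x:S|lebesgue. h x) = (\<Sum>K\<in>C. LINT x:K|lebesgue. h x)"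
proof -
  have m: "\<Union>C \<in> sets lebesgue" using C by (auto intro: sets.finite_Union)
  have i: "set_integrable lebesgue (\<Union>C) h"
    using h m C(4) by (intro set_integrable_subset[OF h]) auto
  have "(LINT x:S|lebesgue. h x) = (LINT x:\<Union>C|lebesgue. h x)"
  proof (rule set_integral_cong_set)
    show "set_borel_measurable lebesgue (\<Union>C) h" "set_borel_measurable lebesgue S h"
      using h i by (auto simp: set_borel_measurable_def set_integrable_def)
    have "AE x in lebesgue. x \<notin> S - \<Union>C"
      using neg by (intro AE_not_in) (simp add: negligible_iff_null_sets)
    then show "AE x in lebesgue. x \<in> \<Union>C \<longleftrightarrow> x \<in> S"
      by (rule AE_mp) (use C(4) in auto)
  qed
  also have "\<dots> = (LINT x:(\<Union>K\<in>C. id K)|lebesgue. h x)" by simp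
  also have "\<dots> = (\<Sum>K\<in>C. LINT x:id K|lebesgue. h x)"
  proof (rule set_integral_finite_Union)
    show "disjoint_family_on id C" using C(2) by (auto simp: disjoint_family_on_def disjoint_def)
    show "set_integrable lebesgue (id i) h" if "i \<in> C" for i
      using C(3,4)[OF that] by (auto intro: set_integrable_subset[OF h])
  qed (use C in auto)
  finally show ?thesis by simp
qed

lemma measure_Int_Diff:
  assumes "A \<in> fmeasurable M" "B \<in> sets M"
  shows "measure M A = measure M (A \<inter> B) + measure M (A - B)"
proof -
  have "A - B = A - (A \<inter> B)" by auto
  then show ?thesis using assms measurable_measure_Diff[of A M "A \<inter> B"] by auto
qed

lemma set_integral_indicator_measure:
  assumes "G \<in> lmeasurable" "S \<in> sets lebesgue"
  shows "set_integrable lebesgue S (indicat_real G)" "(LINT x:S|lebesgue. indicat_real G x) = measure lebesgue (G \<inter> S)"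
proof -
  have m: "G \<inter> S \<in> lmeasurable" using assms by (intro fmeasurable_Int_fmeasurable)
  have e: "(\<lambda>x. indicat_real S x *\<^sub>R indicat_real G x) = indicat_real (G \<inter> S)"
    by (auto simp: fun_eq_iff split: split_indicator)
  show "set_integrable lebesgue S (indicat_real G)"
    unfolding set_integrable_def e using m by (simp add: lmeasurable_iff_integrable)
  show "(LINT x:S|lebesgue. indicat_real G x) = measure lebesgue (G \<inter> S)"
    unfolding set_lebesgue_integral_def e using m by simp
qed

lemma measure_ae_partition:
  fixes G :: "'a::euclidean_space set"
  assumes C: "finite C" "disjoint C" "\<And>K. K \<in> C \<Longrightarrow> K \<in> sets lebesgue" "\<And>K. K \<in> C \<Longrightarrow> K \<subseteq> S"
    and neg: "negligible (S - \<Union>C)" and S: "S \<in> sets lebesgue" and G: "G \<in> lmeasurable"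
  shows "measure lebesgue (G \<inter> S) = (\<Sum>K\<in>C. measure lebesgue (G \<inter> K))"
  using set_integral_ae_partition[OF C neg S set_integral_indicator_measure(1)[OF G S]]
    set_integral_indicator_measure(2)[OF G] S C(3) by simp

text \<open>Oscillation about some constant rather than about the mean. It agrees with
  \<open>mean_osc\<close> up to a factor 2, and it passes easily through sums, absolute values and
  bounds because any constant may serve as witness.\<close>

definition near_const :: "real \<Rightarrow> 'a::euclidean_space set \<Rightarrow> ('a \<Rightarrow> real) \<Rightarrow> bool" where
  "near_const e K f \<longleftrightarrow> (\<exists>c. (LINT x:K|lebesgue. \<bar>f x - c\<bar>) \<le> e * measure lebesgue K)"

lemma near_const_nonneg:
  assumes "near_const e K f" "measure lebesgue K > 0"
  shows "e \<ge> 0"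
proof -
  obtain c where "(LINT x:K|lebesgue. \<bar>f x - c\<bar>) \<le> e * measure lebesgue K"
    using assms by (auto simp: near_const_def)
  moreover have "0 \<le> (LINT x:K|lebesgue. \<bar>f x - c\<bar>)"
    unfolding set_lebesgue_integral_def by (intro integral_nonneg_AE) auto
  ultimately show ?thesis using assms by (smt (verit) mult_neg_pos)
qed

lemma set_integrable_const_lmeasurable: "S \<in> lmeasurable \<Longrightarrow> set_integrable lebesgue S (\<lambda>x. c::real)"
  unfolding set_integrable_def by (simp add: lmeasurable_iff_integrable)

lemma set_integral_const_lmeasurable: "S \<in> lmeasurable \<Longrightarrow> (LINT x:S|lebesgue. (c::real)) = c * measure lebesgue S"
  unfolding set_lebesgue_integral_def by simp

lemma set_integrable_pos_part:
  fixes f :: "'a \<Rightarrow> real"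
  assumes "set_integrable M S f" shows "set_integrable M S (\<lambda>x. max 0 (f x))"
proof -
  have "(\<lambda>x. indicator S x *\<^sub>R max 0 (f x)) = (\<lambda>x. max 0 (indicator S x *\<^sub>R f x))"
    by (auto split: split_indicator)
  then show ?thesis using assms unfolding set_integrable_def by auto
qed

lemma set_integral_mono_set:
  fixes f :: "'a \<Rightarrow> real"
  assumes "set_integrable M S f" "T \<in> sets M" "T \<subseteq> S" "\<And>x. x \<in> S \<Longrightarrow> 0 \<le> f x"
  shows "(LINT x:T|M. f x) \<le> (LINT x:S|M. f x)"
  unfolding set_lebesgue_integral_def
  using set_integrable_subset[OF assms(1-3)] assms unfolding set_integrable_def
  by (intro integral_mono) (auto split: split_indicator)

text \<open>If the constant \<open>c\<close> exceeds \<alpha>, then |f - c| is at least c - \<alpha>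
  on \<open>L\<close>, which has 3/8 of the measure of \<open>K\<close>; hence c - \<alpha> is at
  most 8/3 e. The excess of \<open>f\<close> over \<alpha> is at most |f - c| plus the positive part
  of c - \<alpha>, and 1 + 8/3 is below 4.\<close>

lemma excess_bound:
  fixes f :: "'a::euclidean_space \<Rightarrow> real"
  assumes K: "K \<in> lmeasurable" and f: "set_integrable lebesgue K f" and near: "near_const e K f"
    and L: "L \<in> sets lebesgue" "L \<subseteq> K" "\<And>x. x \<in> L \<Longrightarrow> f x \<le> \<alpha>" "measure lebesgue L \<ge> 3/8 * measure lebesgue K"
  shows "(LINT x:K|lebesgue. max 0 (f x - \<alpha>)) \<le> 4 * e * measure lebesgue K"
proof -
  obtain c where c: "(LINT x:K|lebesgue. \<bar>f x - c\<bar>) \<le> e * measure lebesgue K"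
    using near by (auto simp: near_const_def)
  have cK: "set_integrable lebesgue K (\<lambda>x. k)" for k :: real
    using K by (rule set_integrable_const_lmeasurable)
  have Lm: "L \<in> lmeasurable" using K L by (auto intro: fmeasurableI2)
  have osc: "set_integrable lebesgue K (\<lambda>x. \<bar>f x - c\<bar>)"
    by (intro set_integrable_abs set_integral_diff(1) f cK)
  have "max 0 (c - \<alpha>) * measure lebesgue L = (LINT x:L|lebesgue. max 0 (c - \<alpha>))"
    using Lm by (simp add: set_integral_const_lmeasurable)
  also have "\<dots> \<le> (LINT x:L|lebesgue. \<bar>f x - c\<bar>)"
    by (rule set_integral_mono[OF set_integrable_const_lmeasurable[OF Lm] set_integrable_subset[OF osc L(1,2)]])
      (use L(3) in force)
  also have "\<dots> \<le> (LINT x:K|lebesgue. \<bar>f x - c\<bar>)"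
    by (rule set_integral_mono_set[OF osc L(1,2)]) auto
  finally have 1: "max 0 (c - \<alpha>) * measure lebesgue L \<le> e * measure lebesgue K" using c by linarith
  have "max 0 (c - \<alpha>) * (3/8 * measure lebesgue K) \<le> max 0 (c - \<alpha>) * measure lebesgue L"
    using L(4) by (intro mult_left_mono) auto
  then have 2: "max 0 (c - \<alpha>) * measure lebesgue K \<le> 8/3 * (e * measure lebesgue K)" using 1 by linarith
  have "0 \<le> (LINT x:K|lebesgue. \<bar>f x - c\<bar>)"
    unfolding set_lebesgue_integral_def by (intro integral_nonneg_AE) auto
  then have e0: "0 \<le> e * measure lebesgue K" using c by linarith
  have "(LINT x:K|lebesgue. max 0 (f x - \<alpha>)) \<le> (LINT x:K|lebesgue. \<bar>f x - c\<bar> + max 0 (c - \<alpha>))"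
    by (rule set_integral_mono) (auto intro!: set_integrable_pos_part set_integral_diff(1) set_integral_add(1) f cK osc)
  also have "\<dots> = (LINT x:K|lebesgue. \<bar>f x - c\<bar>) + max 0 (c - \<alpha>) * measure lebesgue K"
    using K by (subst set_integral_add(2)) (auto intro: osc cK simp: set_integral_const_lmeasurable)
  also have "\<dots> \<le> 4 * e * measure lebesgue K" using c 2 e0 by linarith
  finally show ?thesis .
qed

text \<open>Dyadic subdivision stops at the first cubes in which the level set \<open>G\<close> has
  density at least \<theta>. In such a cube the density is also bounded away from 1, so
  \<open>excess_bound\<close> applies, and the density from below turns the measure of the cube into
  a multiple of the measure of its part of \<open>G\<close>. Almost every point of \<open>G\<close>
  lies in a selected cube.\<close>

lemma calderon_zygmund_cube:
  fixes f :: "'a::euclidean_space \<Rightarrow> real"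
  assumes Q: "is_cube Q" and f: "set_integrable lebesgue Q f"
    and near: "\<And>K. K \<in> subcubes Q \<Longrightarrow> near_const e K f"
    and dens: "measure lebesgue {x \<in> Q. f x > \<alpha>} \<le> 5/8 * measure lebesgue Q"
  shows "(LINT x:Q|lebesgue. max 0 (f x - \<alpha>)) \<le> 2 ^ (DIM('a) + 3) * e * measure lebesgue {x \<in> Q. f x > \<alpha>}"
proof -
  note Qm = is_cube_lmeasurable[OF Q]
  then have Qs: "Q \<in> sets lebesgue" by auto
  define G where "G = {x \<in> Q. f x > \<alpha>}"
  define h where "h x = max 0 (f x - \<alpha>)" for x
  \<comment> \<open>A child has measure 1 / 2 ^ n of its parent, \<open>n\<close> being the
    dimension, so density below \<theta> in the parent means density at most 1/2 in the child. The
    bound \<theta> \<le> 1/4 yields the contradiction in the proof that \<open>B\<close> is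
    null.\<close>
  define \<theta> :: real where "\<theta> = 1 / 2 ^ (DIM('a) + 1)"
  have \<theta>: "0 < \<theta>" "\<theta> \<le> 1/4"
  proof -
    have "2 ^ 1 \<le> (2::real) ^ DIM('a)" by (rule power_increasing) (auto simp: Suc_le_eq)
    then show "0 < \<theta>" "\<theta> \<le> 1/4" by (auto simp: \<theta>_def field_simps)
  qed
  have e0: "e \<ge> 0"
    using near_const_nonneg[OF near[of Q] is_cube_measure_pos[OF Q]] Q by (simp add: subcubes_def)
  \<comment> \<open>Since C * \<theta> = 4 * e, a bound 4 * e times the measure of a cube becomes
    \<open>C\<close> times the measure of its part of \<open>G\<close> once \<open>G\<close> fills
    at least \<theta> of it.\<close>
  define C where "C = 2 ^ (DIM('a) + 3) * e"
  have C\<theta>: "C * \<theta> = 4 * e" by (simp add: C_def \<theta>_def power_add)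
  have C0: "C \<ge> 0" using e0 by (simp add: C_def)
  have h: "set_integrable lebesgue Q h"
    unfolding h_def by (intro set_integrable_pos_part set_integral_diff(1) f set_integrable_const_lmeasurable Qm)
  have hG: "h x = 0" if "x \<in> Q" "x \<notin> G" for x using that by (auto simp: G_def h_def)
  have Gs: "G \<in> sets lebesgue"
  proof -
    have "(\<lambda>x. indicator Q x *\<^sub>R h x) \<in> borel_measurable lebesgue"
      using h unfolding set_integrable_def by blast
    then have "{x \<in> space lebesgue. indicator Q x *\<^sub>R h x > 0} \<in> sets lebesgue" by measurable
    also have "{x \<in> space lebesgue. indicator Q x *\<^sub>R h x > 0} = G"
      by (auto simp: G_def h_def split: split_indicator)
    finally show ?thesis .
  qed
  have Gm: "G \<in> lmeasurable"
    by (rule fmeasurableI2[OF Qm _ Gs]) (auto simp: G_def)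
  have cube_m: "K \<in> lmeasurable" "K \<in> sets lebesgue" "K \<subseteq> Q" "is_cube K" if "K \<in> subcubes Q" for K
    using that is_cube_lmeasurable[of K] by (auto simp: subcubes_def)
  have excess: "(LINT x:K|lebesgue. h x) \<le> C * measure lebesgue (G \<inter> K)"
    if K: "K \<in> subcubes Q" and d: "measure lebesgue (G \<inter> K) \<le> 5/8 * measure lebesgue K"
      "measure lebesgue (G \<inter> K) \<ge> \<theta> * measure lebesgue K" for K
  proof -
    have "(LINT x:K|lebesgue. h x) \<le> 4 * e * measure lebesgue K" unfolding h_def
    proof (rule excess_bound[OF _ _ near[OF K]])
      show "K - G \<in> sets lebesgue" "K - G \<subseteq> K" using cube_m[OF K] Gs by auto
      show "set_integrable lebesgue K f" using cube_m[OF K] by (intro set_integrable_subset[OF f])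
      show "f x \<le> \<alpha>" if "x \<in> K - G" for x using that cube_m[OF K] by (auto simp: G_def)
      have "measure lebesgue (K - G) = measure lebesgue K - measure lebesgue (G \<inter> K)"
        using measure_Int_Diff[OF cube_m(1)[OF K] Gs] by (simp add: Int_commute)
      then show "3/8 * measure lebesgue K \<le> measure lebesgue (K - G)" using d(1) by linarith
    qed (use cube_m[OF K] in auto)
    also have "\<dots> = C * (\<theta> * measure lebesgue K)" using C\<theta> by (simp add: mult.assoc[symmetric])
    also have "\<dots> \<le> C * measure lebesgue (G \<inter> K)" using d(2) C0 by (rule mult_left_mono)
    finally show ?thesis .
  qed
  have "(LINT x:Q|lebesgue. h x) \<le> C * measure lebesgue G"
  proof (cases "measure lebesgue (G \<inter> Q) \<ge> \<theta> * measure lebesgue Q")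
    \<comment> \<open>The whole cube is already selected; the hypothesis \<open>dens\<close> plays
      the part of the upper density bound that other selected cubes inherit from their
      parents.\<close>
    case True
    have "G \<inter> Q = G" by (auto simp: G_def)
    then show ?thesis using excess[of Q] Q True dens by (auto simp: subcubes_def G_def)
  next
    case False
    obtain D r where D0: "D 0 = {Q}" and Dfin: "\<And>m. finite (D m)" and Ddis: "\<And>m. disjoint (D m)"
      and Dneg: "\<And>m. negligible (Q - \<Union>(D m))" and Dsub: "\<And>m K. K \<in> D m \<Longrightarrow> K \<in> subcubes Q"
      and Dmeas: "\<And>m K. K \<in> D m \<Longrightarrow> measure lebesgue K * 2 ^ (DIM('a) * m) = measure lebesgue Q"
      and Dbox: "\<And>m K. K \<in> D m \<Longrightarrow> \<exists>y. K = box y (y + (r / 2 ^ m) *\<^sub>R One)"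
      and r: "r > 0" and Dnest: "\<And>m K. K \<in> D (Suc m) \<Longrightarrow> \<exists>K'\<in>D m. K \<subseteq> K'"
      and Ddiam: "\<And>m K x y. K \<in> D m \<Longrightarrow> x \<in> K \<Longrightarrow> y \<in> K \<Longrightarrow> dist x y \<le> real DIM('a) * r / 2 ^ m"
      by (rule dyadic_grid[OF Q]) (rule that; (assumption | blast))
    define low where "low K \<longleftrightarrow> measure lebesgue (G \<inter> K) < \<theta> * measure lebesgue K" for K
    \<comment> \<open>\<open>U m\<close> collects the level-\<open>m\<close> cubes at which the selection has not stopped yet, \<open>R m\<close> the cubes
      selected at level \<open>Suc m\<close>; the density of \<open>G\<close> in a cube of \<open>R m\<close> is at most \<open>1/2\<close> because it is
      below \<open>\<theta>\<close> in the parent.\<close>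
    define U where "U = rec_nat {Q} (\<lambda>m X. {K \<in> D (Suc m). low K \<and> (\<exists>K'\<in>X. K \<subseteq> K')})"
    have U0: "U 0 = {Q}" and USuc: "U (Suc m) = {K \<in> D (Suc m). low K \<and> (\<exists>K'\<in>U m. K \<subseteq> K')}" for m
      by (auto simp: U_def)
    define R where "R m = {K \<in> D (Suc m). \<not> low K \<and> (\<exists>K'\<in>U m. K \<subseteq> K')}" for m
    have UD: "U m \<subseteq> D m" for m using U0 USuc D0 by (cases m) auto
    have Ulow: "low K" if "K \<in> U m" for m K
      using False U0 USuc that by (cases m) (auto simp: low_def)
    have Ufin: "finite (U m)" for m using Dfin UD by (blast intro: finite_subset)
    have Rfin: "finite (R m)" for m using Dfin by (simp add: R_def)
    define W where "W m = \<Union>(U m)" for m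
    have URD: "U (Suc m) \<union> R m \<subseteq> D (Suc m)" for m by (auto simp: USuc R_def)
    have WQ: "W m \<subseteq> Q" for m using UD Dsub by (fastforce simp: W_def subcubes_def)
    have Wm: "W m \<in> sets lebesgue" for m
      using Ufin UD Dsub cube_m(2) unfolding W_def by (blast intro: sets.finite_Union)
    have Wdec: "W (Suc m) \<subseteq> W m" for m by (auto simp: W_def USuc)
    have neg: "negligible (W m - \<Union>(U (Suc m) \<union> R m))" for m
    proof (rule negligible_subset[OF Dneg[of "Suc m"]])
      show "W m - \<Union>(U (Suc m) \<union> R m) \<subseteq> Q - \<Union>(D (Suc m))"
      proof (safe)
        fix x K K' assume x: "x \<in> W m" "x \<notin> \<Union>(U (Suc m) \<union> R m)" and K: "x \<in> K" "K \<in> D (Suc m)"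
        obtain K' where K': "K' \<in> U m" "x \<in> K'" using x by (auto simp: W_def)
        obtain K2 where K2: "K2 \<in> D m" "K \<subseteq> K2" using Dnest K by blast
        \<comment> \<open>Cubes of one level are disjoint, so the parent of \<open>K\<close> must be
          the member of \<open>U m\<close> that contains \<open>x\<close>.\<close>
        have "K2 = K'" using Ddis[of m] K2 K' K UD by (metis disjointD disjoint_iff subsetD)
        then show False using x K K2 K' by (auto simp: USuc R_def)
      next
        fix x assume "x \<in> W m" then show "x \<in> Q" using WQ by auto
      qed
    qed
    have UR: "finite (U (Suc m) \<union> R m)" "disjoint (U (Suc m) \<union> R m)" "U (Suc m) \<inter> R m = {}" for m
      using Ufin Rfin pairwise_subset[OF Ddis URD] by (blast, blast, auto simp: USuc R_def)
    have URs: "K \<in> sets lebesgue" "K \<subseteq> W m" if "K \<in> U (Suc m) \<union> R m" for K m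
      using that Dsub cube_m(2) URD by (blast, auto simp: W_def USuc R_def)
    have hW: "set_integrable lebesgue (W m) h" for m by (rule set_integrable_subset[OF h Wm WQ])
    have Wint: "(LINT x:W m|lebesgue. g x) = (LINT x:W (Suc m)|lebesgue. g x) + (\<Sum>K\<in>R m. LINT x:K|lebesgue. g x)"
      if g: "set_integrable lebesgue Q g" for g :: "'a \<Rightarrow> real" and m
    proof -
      have gW: "set_integrable lebesgue (W m) g" for m by (rule set_integrable_subset[OF g Wm WQ])
      have "(LINT x:W m|lebesgue. g x) = (\<Sum>K\<in>U (Suc m) \<union> R m. LINT x:K|lebesgue. g x)"
        by (rule set_integral_ae_partition[OF UR(1,2) URs neg Wm gW])
      also have "\<dots> = (\<Sum>K\<in>U (Suc m). LINT x:K|lebesgue. g x) + (\<Sum>K\<in>R m. LINT x:K|lebesgue. g x)"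
        by (rule sum.union_disjoint[OF Ufin Rfin UR(3)])
      also have "(\<Sum>K\<in>U (Suc m). LINT x:K|lebesgue. g x) = (LINT x:W (Suc m)|lebesgue. g x)"
        by (rule set_integral_ae_partition[symmetric, OF Ufin _ _ _ _ Wm gW])
          (use UR(2) URs in \<open>auto simp: W_def intro: pairwise_subset\<close>)
      finally show ?thesis .
    qed
    have Rexc: "(LINT x:K|lebesgue. h x) \<le> C * measure lebesgue (G \<inter> K)" if K: "K \<in> R m" for K m
    proof -
      obtain K' where K': "K' \<in> U m" "K \<subseteq> K'" and KD: "K \<in> D (Suc m)" and nl: "\<not> low K" using K by (auto simp: R_def)
      have s: "K \<in> subcubes Q" "K' \<in> subcubes Q" using KD K' UD Dsub by blast+
      have "measure lebesgue K' * 2 ^ (DIM('a) * m) = measure lebesgue K * 2 ^ (DIM('a) * Suc m)"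
        using Dmeas KD K' UD by (metis subsetD)
      then have KK: "measure lebesgue K' = 2 ^ DIM('a) * measure lebesgue K" by (simp add: power_add)
      have "measure lebesgue (G \<inter> K) \<le> measure lebesgue (G \<inter> K')"
        using K'(2) Gm s cube_m(2) by (intro measure_mono_fmeasurable fmeasurable_Int_fmeasurable) auto
      also have "\<dots> \<le> \<theta> * measure lebesgue K'" using Ulow[OF K'(1)] by (simp add: low_def)
      also have "\<dots> = 1/2 * measure lebesgue K" unfolding KK by (simp add: \<theta>_def)
      also have "\<dots> \<le> 5/8 * measure lebesgue K" by (intro mult_right_mono) auto
      finally show ?thesis using nl s by (intro excess) (auto simp: low_def)
    qed
    have Gi: "set_integrable lebesgue Q (indicat_real G)" using set_integral_indicator_measure[OF Gm Qs] by simp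
    \<comment> \<open>Passing from \<open>W m\<close> to \<open>W (Suc m)\<close> removes the
      selected cubes, on each of which the excess is at most \<open>C\<close> times the measure of
      its part of \<open>G\<close>; the difference therefore cannot decrease.\<close>
    have step: "(LINT x:W m|lebesgue. h x) - C * measure lebesgue (G \<inter> W m)
        \<le> (LINT x:W (Suc m)|lebesgue. h x) - C * measure lebesgue (G \<inter> W (Suc m))" for m
    proof -
      have "measure lebesgue (G \<inter> W m) = measure lebesgue (G \<inter> W (Suc m)) + (\<Sum>K\<in>R m. measure lebesgue (G \<inter> K))"
      proof -
        have "(\<Sum>K\<in>R m. LINT x:K|lebesgue. indicat_real G x) = (\<Sum>K\<in>R m. measure lebesgue (G \<inter> K))"
          by (intro sum.cong refl set_integral_indicator_measure(2)[OF Gm] URs(1)[of _ m]) auto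
        then show ?thesis
          using Wint[OF Gi, of m] set_integral_indicator_measure(2)[OF Gm] Wm by simp
      qed
      moreover have "(\<Sum>K\<in>R m. LINT x:K|lebesgue. h x) \<le> C * (\<Sum>K\<in>R m. measure lebesgue (G \<inter> K))"
        unfolding sum_distrib_left by (rule sum_mono) (rule Rexc)
      ultimately show ?thesis using Wint[OF h, of m] by (simp add: algebra_simps)
    qed
    have all: "(LINT x:Q|lebesgue. h x) - C * measure lebesgue G \<le> (LINT x:W m|lebesgue. h x)" for m
    proof -
      have "(LINT x:W 0|lebesgue. h x) - C * measure lebesgue (G \<inter> W 0) \<le> (LINT x:W m|lebesgue. h x) - C * measure lebesgue (G \<inter> W m)"
        using step by (induction m) (auto intro: order_trans)
      moreover have "W 0 = Q" "G \<inter> Q = G" by (auto simp: W_def U0 G_def)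
      moreover have "0 \<le> C * measure lebesgue (G \<inter> W m)" using C0 by simp
      ultimately show ?thesis by simp
    qed
    \<comment> \<open>The points of \<open>G\<close> that lie in a not yet stopped cube at every
      level.\<close>
    define B where "B = G \<inter> (\<Inter>m. W m)"
    have Bs: "B \<in> sets lebesgue" using Gs Wm by (auto simp: B_def)
    have Bm: "B \<in> lmeasurable" by (rule fmeasurableI2[OF Gm _ Bs]) (auto simp: B_def)
    \<comment> \<open>This replaces the Lebesgue density theorem: the unselected cubes inside a tight open
      neighbourhood of \<open>B\<close> would have to fill at least \<open>1 / \<theta>\<close> times the measure of \<open>B\<close>.\<close>
    have B0: "measure lebesgue B = 0"
    proof (rule ccontr)
      assume "measure lebesgue B \<noteq> 0"
      then have pos: "measure lebesgue B > 0" using measure_nonneg[of lebesgue B] by linarith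
      obtain T where T: "open T" "B \<subseteq> T" "T - B \<in> lmeasurable" "emeasure lebesgue (T - B) < ennreal (measure lebesgue B)"
        using sets_lebesgue_outer_open[OF Bs pos] by metis
      have TB: "measure lebesgue (T - B) < measure lebesgue B"
        using T(3,4) pos by (simp add: emeasure_eq_measure2 ennreal_less_iff)
      have "T = B \<union> (T - B)" using T(2) by auto
      then have Tm: "T \<in> lmeasurable" using Bm T(3) by (metis fmeasurable.Un)
      have "measure lebesgue T = measure lebesgue B + measure lebesgue (T - B)"
        using Tm Bm T(2) by (simp add: measurable_measure_Diff)
      then have T2: "measure lebesgue T < 2 * measure lebesgue B" using TB by simp
      define V where "V m = \<Union>{K \<in> U m. K \<subseteq> T}" for m
      have Vs: "V m \<in> sets lebesgue" for m
        using Ufin[of m] UD[of m] Dsub cube_m(2) unfolding V_def by (intro sets.finite_Union) auto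
      have GV: "measure lebesgue (G \<inter> V m) \<le> \<theta> * measure lebesgue T" for m
      proof -
        define X where "X = {K \<in> U m. K \<subseteq> T}"
        have XU: "X \<subseteq> U m" by (auto simp: X_def)
        have P: "finite X" "disjoint X" "\<And>K. K \<in> X \<Longrightarrow> K \<in> sets lebesgue"
          "\<And>K. K \<in> X \<Longrightarrow> K \<subseteq> V m" "negligible (V m - \<Union>X)"
        proof -
          show "finite X" using Ufin XU by (rule finite_subset[rotated])
          show "disjoint X" using Ddis by (rule pairwise_subset) (use XU UD in blast)
          show "K \<in> sets lebesgue" if "K \<in> X" for K using that XU UD Dsub cube_m(2) by blast
        qed (auto simp: V_def X_def)
        have "measure lebesgue (G \<inter> V m) = (\<Sum>K\<in>X. measure lebesgue (G \<inter> K))"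
          by (rule measure_ae_partition[OF P Vs Gm])
        also have "\<dots> \<le> (\<Sum>K\<in>X. \<theta> * measure lebesgue (T \<inter> K))"
          using Ulow by (intro sum_mono) (auto simp: X_def low_def Int_absorb1 intro: less_imp_le)
        also have "\<dots> = \<theta> * measure lebesgue (T \<inter> V m)"
          by (simp add: measure_ae_partition[OF P Vs Tm] sum_distrib_left)
        also have "\<dots> \<le> \<theta> * measure lebesgue T"
          using \<theta> Tm Vs by (intro mult_left_mono measure_mono_fmeasurable) auto
        finally show ?thesis .
      qed
      \<comment> \<open>The points of \<open>B\<close> whose dyadic cubes lie in \<open>T\<close>
        from level \<open>m\<close> on. These sets increase to \<open>B\<close>, because
        \<open>T\<close> is open and the diameters of the cubes tend to 0.\<close>
      define Bk where "Bk m = B \<inter> (\<Inter>j\<in>{m..}. V j)" for m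
      have Bks: "Bk m \<in> sets lebesgue" for m using Bs Vs by (auto simp: Bk_def)
      have "(\<Union>m. Bk m) = B"
      proof (intro equalityI subsetI)
        fix x assume x: "x \<in> B"
        obtain d where d: "d > 0" "ball x d \<subseteq> T" using x T open_contains_ball by blast
        have "(\<lambda>m. DIM('a) * r / 2 ^ m) \<longlonglongrightarrow> 0" by real_asymp
        then have "\<forall>\<^sub>F m in sequentially. DIM('a) * r / 2 ^ m < d" using d(1) order_tendstoD(2) by blast
        then obtain m where m: "\<And>j. j \<ge> m \<Longrightarrow> DIM('a) * r / 2 ^ j < d" by (auto simp: eventually_sequentially)
        have "x \<in> V j" if "j \<ge> m" for j
        proof -
          obtain K where K: "K \<in> U j" "x \<in> K" using x by (auto simp: B_def W_def)
          have "K \<subseteq> ball x d" using Ddiam[of K j x] K UD m[OF that] by (fastforce simp: mem_ball)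
          then show ?thesis using K d by (auto simp: V_def)
        qed
        then show "x \<in> (\<Union>m. Bk m)" using x by (auto simp: Bk_def)
      qed (auto simp: Bk_def)
      moreover have "(\<lambda>m. measure lebesgue (Bk m)) \<longlonglongrightarrow> measure lebesgue (\<Union>m. Bk m)"
      proof (rule Lim_measure_incseq)
        show "incseq Bk" by (rule incseq_SucI) (auto simp: Bk_def)
        show "emeasure lebesgue (\<Union>m. Bk m) \<noteq> \<infinity>"
          unfolding \<open>(\<Union>m. Bk m) = B\<close> using Bm by (simp add: emeasure_eq_measure2)
      qed (use Bks in auto)
      moreover have "measure lebesgue (Bk m) \<le> \<theta> * measure lebesgue T" for m
      proof -
        have "measure lebesgue (Bk m) \<le> measure lebesgue (G \<inter> V m)"
          using Gm Vs Bks by (intro measure_mono_fmeasurable fmeasurable_Int_fmeasurable) (auto simp: Bk_def B_def)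
        then show ?thesis using GV[of m] by linarith
      qed
      ultimately have "measure lebesgue B \<le> \<theta> * measure lebesgue T"
        by (intro LIMSEQ_le_const2[of "\<lambda>m. measure lebesgue (Bk m)"]) auto
      also have "\<dots> \<le> 1/4 * measure lebesgue T" using \<theta> by (intro mult_right_mono) auto
      finally show False using T2 pos by linarith
    qed
    \<comment> \<open>By continuity from above the remaining excess tends to the excess on the
      intersection of all \<open>W m\<close>. That one is zero: \<open>h\<close> vanishes on
      \<open>Q\<close> off \<open>G\<close>, and the part in \<open>G\<close> is the null set
      \<open>B\<close>.\<close>
    have lim: "(\<lambda>m. LINT x:W m|lebesgue. h x) \<longlonglongrightarrow> (LINT x:(\<Inter>m. W m)|lebesgue. h x)"
      by (rule set_integral_cont_down) (use Wm hW decseq_SucI[of W, OF Wdec] in auto)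
    have "AE x in lebesgue. x \<notin> B"
      using B0 Bm by (intro AE_not_in) (simp add: null_sets_def emeasure_eq_measure2 Bs)
    then have "AE x in lebesgue. indicator (\<Inter>m. W m) x *\<^sub>R h x = 0"
      by (rule AE_mp) (use hG WQ in \<open>fastforce simp: B_def split: split_indicator\<close>)
    then have "(LINT x:(\<Inter>m. W m)|lebesgue. h x) = 0"
      unfolding set_lebesgue_integral_def by (rule integral_eq_zero_AE)
    with lim have "(\<lambda>m. LINT x:W m|lebesgue. h x) \<longlonglongrightarrow> 0" by simp
    then have "(LINT x:Q|lebesgue. h x) - C * measure lebesgue G \<le> 0"
      using all by (intro LIMSEQ_le_const) auto
    then show ?thesis by simp
  qed
  then show ?thesis by (simp add: h_def C_def G_def)
qed

text \<open>Integrability on \<open>S\<close> gives measurability of the extension of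
  \<open>f\<close> by zero; the preimage under this extension is cut down to
  \<open>S\<close>.\<close>

lemma set_integrable_level_set:
  fixes f :: "'a \<Rightarrow> real"
  assumes "set_integrable M S f" "S \<in> sets M" "B \<in> sets borel"
  shows "{x \<in> S. f x \<in> B} \<in> sets M"
proof -
  have m: "(\<lambda>x. indicator S x *\<^sub>R f x) \<in> borel_measurable M"
    using assms unfolding set_integrable_def by blast
  have "{x \<in> S. f x \<in> B} = S \<inter> ((\<lambda>x. indicator S x *\<^sub>R f x) -` B \<inter> space M)"
    using sets.sets_into_space[OF assms(2)] by auto
  then show ?thesis using measurable_sets[OF m assms(3)] assms(2) by simp
qed

text \<open>The estimates for the cubes of \<open>D\<close> add up. Oscillation and density are
  controlled at the scale of \<open>D\<close> only, since small oscillation is available only on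
  small cubes.\<close>

lemma calderon_zygmund_grid:
  fixes f :: "'a::euclidean_space \<Rightarrow> real"
  assumes Q: "is_cube Q" and f: "set_integrable lebesgue Q f"
    and D: "finite D" "disjoint D" "negligible (Q - \<Union>D)" "D \<subseteq> subcubes Q"
    and near: "\<And>K J. K \<in> D \<Longrightarrow> J \<in> subcubes K \<Longrightarrow> near_const e J f"
    and dens: "\<And>K. K \<in> D \<Longrightarrow> measure lebesgue {x \<in> K. f x > \<alpha>} \<le> 5/8 * measure lebesgue K"
  shows "(LINT x:Q|lebesgue. max 0 (f x - \<alpha>)) \<le> 2 ^ (DIM('a) + 3) * e * measure lebesgue {x \<in> Q. f x > \<alpha>}"
proof -
  note Qm = is_cube_lmeasurable[OF Q]
  then have Qs: "Q \<in> sets lebesgue" by auto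
  define G where "G = {x \<in> Q. f x > \<alpha>}"
  have "G = {x \<in> Q. f x \<in> {\<alpha><..}}" by (auto simp: G_def)
  then have Gs: "G \<in> sets lebesgue" using set_integrable_level_set[OF f Qs, of "{\<alpha><..}"] by simp
  have Gm: "G \<in> lmeasurable" by (rule fmeasurableI2[OF Qm _ Gs]) (auto simp: G_def)
  have Kc: "is_cube K" "K \<subseteq> Q" "K \<in> sets lebesgue" if "K \<in> D" for K
    using that D(4) is_cube_lmeasurable[of K] by (auto simp: subcubes_def)
  have GK: "{x \<in> K. f x > \<alpha>} = G \<inter> K" if "K \<in> D" for K using Kc[OF that] by (auto simp: G_def)
  have h: "set_integrable lebesgue Q (\<lambda>x. max 0 (f x - \<alpha>))"
    by (intro set_integrable_pos_part set_integral_diff(1) f set_integrable_const_lmeasurable Qm)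
  have "(LINT x:Q|lebesgue. max 0 (f x - \<alpha>)) = (\<Sum>K\<in>D. LINT x:K|lebesgue. max 0 (f x - \<alpha>))"
    by (rule set_integral_ae_partition[OF D(1,2) _ _ D(3) Qs h]) (use Kc in auto)
  also have "\<dots> \<le> (\<Sum>K\<in>D. 2 ^ (DIM('a) + 3) * e * measure lebesgue (G \<inter> K))"
  proof (rule sum_mono)
    fix K assume K: "K \<in> D"
    show "(LINT x:K|lebesgue. max 0 (f x - \<alpha>)) \<le> 2 ^ (DIM('a) + 3) * e * measure lebesgue (G \<inter> K)"
      using calderon_zygmund_cube[OF Kc(1)[OF K] set_integrable_subset[OF f Kc(3,2)] near[OF K] dens[OF K]]
      using GK[OF K] K by simp
  qed
  also have "\<dots> = 2 ^ (DIM('a) + 3) * e * measure lebesgue (G \<inter> Q)"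
    unfolding sum_distrib_left[symmetric] by (subst measure_ae_partition[OF D(1,2) _ _ D(3) Qs Gm]) (use Kc in auto)
  also have "G \<inter> Q = G" by (auto simp: G_def)
  finally show ?thesis by (simp add: G_def)
qed

section \<open>Translated cubes and the density of a set in them\<close>

lemma tendsto_measure_moving_cube:
  fixes G :: "'a::euclidean_space set"
  assumes G: "G \<in> lmeasurable" and y: "y \<longlonglongrightarrow> l"
  shows "(\<lambda>k. measure lebesgue (G \<inter> box (y k) (y k + s *\<^sub>R One))) \<longlonglongrightarrow> measure lebesgue (G \<inter> box l (l + s *\<^sub>R One))"
proof -
  let ?B = "\<lambda>y::'a. box y (y + s *\<^sub>R One)"
  have m: "G \<inter> ?B z \<in> lmeasurable" for z using G by (intro fmeasurable_Int_fmeasurable) auto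
  \<comment> \<open>A point off the frontier of the limit cube satisfies finitely many strict
    inequalities, or violates one strictly, and this persists for nearby cubes. So the indicators
    converge outside the null frontier, dominated by that of \<open>G\<close>.\<close>
  have "(\<lambda>k. LINT x|lebesgue. indicat_real (G \<inter> ?B (y k)) x) \<longlonglongrightarrow> (LINT x|lebesgue. indicat_real (G \<inter> ?B l) x)"
  proof (rule integral_dominated_convergence[where w = "indicat_real G"])
    show "integrable lebesgue (indicat_real G)" using G by (simp add: lmeasurable_iff_integrable)
    show "indicat_real (G \<inter> ?B z) \<in> borel_measurable lebesgue" for z
      using m[of z] by (intro borel_measurable_indicator) auto
    then show "indicat_real (G \<inter> ?B z) \<in> borel_measurable lebesgue" for z .
    have "negligible (frontier (?B l))" by (rule negligible_convex_frontier) simp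
    then have "AE x in lebesgue. x \<notin> frontier (?B l)"
      by (intro AE_not_in) (simp add: negligible_iff_null_sets)
    then show "AE x in lebesgue. (\<lambda>k. indicat_real (G \<inter> ?B (y k)) x) \<longlonglongrightarrow> indicat_real (G \<inter> ?B l) x"
    proof (rule AE_mp, intro AE_I2 impI)
      fix x assume x: "x \<notin> frontier (?B l)"
      have yi: "(\<lambda>k. y k \<bullet> i) \<longlonglongrightarrow> l \<bullet> i" for i by (intro tendsto_intros y)
      have "\<forall>\<^sub>F k in sequentially. x \<in> ?B (y k) \<longleftrightarrow> x \<in> ?B l"
      proof (cases "x \<in> ?B l")
        case True
        have "\<forall>\<^sub>F k in sequentially. \<forall>i\<in>Basis. y k \<bullet> i < x \<bullet> i \<and> x \<bullet> i - s < y k \<bullet> i"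
        proof (intro eventually_ball_finite finite_Basis ballI eventually_conj)
          fix i :: 'a assume i: "i \<in> Basis"
          have "l \<bullet> i < x \<bullet> i" "x \<bullet> i - s < l \<bullet> i" using True i by (auto simp: mem_box inner_add_left)
          then show "\<forall>\<^sub>F k in sequentially. y k \<bullet> i < x \<bullet> i" "\<forall>\<^sub>F k in sequentially. x \<bullet> i - s < y k \<bullet> i"
            using order_tendstoD[OF yi] by auto
        qed
        then show ?thesis
        proof (rule eventually_mono)
          fix k assume k: "\<forall>i\<in>Basis. y k \<bullet> i < x \<bullet> i \<and> x \<bullet> i - s < y k \<bullet> i"
          have "x \<in> ?B (y k)" using k by (simp add: mem_box inner_add_left diff_less_eq)
          then show "x \<in> ?B (y k) \<longleftrightarrow> x \<in> ?B l" using True by simp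
        qed
      next
        case False
        have "x \<notin> closure (?B l)" using x False unfolding frontier_def by (simp add: interior_open open_box)
        show ?thesis
        proof (cases "s > 0")
          case True
          then have "?B l \<noteq> {}" by (auto simp: box_eq_empty inner_add_left not_le)
          then have "x \<notin> cbox l (l + s *\<^sub>R One)" using \<open>x \<notin> closure (?B l)\<close> by simp
          then obtain i where i: "i \<in> Basis" "x \<bullet> i < l \<bullet> i \<or> l \<bullet> i < x \<bullet> i - s"
            unfolding mem_box by (auto simp: inner_add_left not_le less_diff_eq)
          then have "\<forall>\<^sub>F k in sequentially. x \<bullet> i < y k \<bullet> i \<or> y k \<bullet> i < x \<bullet> i - s"
            using order_tendstoD(1)[OF yi, of "x \<bullet> i" i] order_tendstoD(2)[OF yi, of i "x \<bullet> i - s"]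
            by (auto elim!: eventually_mono)
          then show ?thesis
          proof (rule eventually_mono)
            fix k assume k: "x \<bullet> i < y k \<bullet> i \<or> y k \<bullet> i < x \<bullet> i - s"
            then have "x \<notin> ?B (y k)" using i(1) unfolding mem_box by (auto simp: inner_add_left intro!: bexI[of _ i])
            then show "x \<in> ?B (y k) \<longleftrightarrow> x \<in> ?B l" using False by simp
          qed
        next
          case False
          moreover have "\<exists>i::'a. i \<in> Basis" using nonempty_Basis by blast
          ultimately have "?B z = {}" for z by (auto simp: box_eq_empty inner_add_left)
          then show ?thesis by simp
        qed
      qed
      then have "\<forall>\<^sub>F k in sequentially. indicat_real (G \<inter> ?B (y k)) x = indicat_real (G \<inter> ?B l) x"
        by (rule eventually_mono) (auto split: split_indicator)
      then show "(\<lambda>k. indicat_real (G \<inter> ?B (y k)) x) \<longlonglongrightarrow> indicat_real (G \<inter> ?B l) x"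
        by (rule tendsto_eventually)
    qed
  qed (auto split: split_indicator)
  then show ?thesis using m by simp
qed

text \<open>Moving one cube to the other along a segment changes the measure of its part of
  \<open>G\<close> continuously, so the intermediate value theorem provides a position with measure
  \<open>v\<close>.\<close>

lemma cube_of_prescribed_density:
  fixes G :: "'a::euclidean_space set"
  assumes G: "G \<in> lmeasurable" and Q: "convex Q"
    and K: "box y (y + s *\<^sub>R One) \<subseteq> Q" "box z (z + s *\<^sub>R One) \<subseteq> Q"
    and v: "measure lebesgue (G \<inter> box y (y + s *\<^sub>R One)) \<le> v" "v \<le> measure lebesgue (G \<inter> box z (z + s *\<^sub>R One))"
  obtains w where "box w (w + s *\<^sub>R One) \<subseteq> Q" "measure lebesgue (G \<inter> box w (w + s *\<^sub>R One)) = v"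
proof -
  define p where "p u = (1 - u) *\<^sub>R y + u *\<^sub>R z" for u :: real
  define \<phi> where "\<phi> u = measure lebesgue (G \<inter> box (p u) (p u + s *\<^sub>R One))" for u
  have "continuous_on UNIV \<phi>"
    unfolding continuous_on_sequentially
  proof (safe, unfold o_def)
    fix x :: "nat \<Rightarrow> real" and l assume x: "x \<longlonglongrightarrow> l"
    have "(\<lambda>k. p (x k)) \<longlonglongrightarrow> p l" unfolding p_def by (intro tendsto_intros x)
    then show "(\<lambda>k. \<phi> (x k)) \<longlonglongrightarrow> \<phi> l" unfolding \<phi>_def by (rule tendsto_measure_moving_cube[OF G])
  qed
  then have "continuous_on {0..1} \<phi>" by (rule continuous_on_subset) auto
  then obtain u where u: "0 \<le> u" "u \<le> 1" "\<phi> u = v"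
    using IVT'[of \<phi> 0 v 1] v by (auto simp: \<phi>_def p_def)
  have "box (p u) (p u + s *\<^sub>R One) \<subseteq> Q"
  proof
    fix x assume x: "x \<in> box (p u) (p u + s *\<^sub>R One)"
    \<comment> \<open>A point at offset \<open>d\<close> in the moving cube is a convex combination
      of the points at the same offset in the two end cubes, so convexity keeps it in
      \<open>Q\<close>.\<close>
    define d where "d = x - p u"
    have "c + d \<in> box c (c + s *\<^sub>R One)" for c
      using x by (auto simp: d_def mem_box inner_add_left inner_diff_left)
    then have "y + d \<in> Q" "z + d \<in> Q" using K by blast+
    then have "(1 - u) *\<^sub>R (y + d) + u *\<^sub>R (z + d) \<in> Q" using u convexD[OF Q, of "y + d" "z + d" "1 - u" u] by simp
    also have "(1 - u) *\<^sub>R (y + d) + u *\<^sub>R (z + d) = x" by (simp add: d_def p_def algebra_simps)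
    finally show "x \<in> Q" .
  qed
  then show thesis using u that unfolding \<phi>_def by blast
qed

section \<open>Oscillation of decreasing functions from one-sided integral bounds\<close>

lemma near_const_bounded:
  assumes "K \<in> lmeasurable" "set_integrable lebesgue K f" "\<And>x. x \<in> K \<Longrightarrow> \<bar>f x - c\<bar> \<le> e"
  shows "near_const e K f"
proof -
  have cK: "set_integrable lebesgue K (\<lambda>x. k)" for k :: real
    using assms(1) by (rule set_integrable_const_lmeasurable)
  have "(LINT x:K|lebesgue. \<bar>f x - c\<bar>) \<le> (LINT x:K|lebesgue. e)"
    by (rule set_integral_mono) (use assms in \<open>auto intro!: set_integrable_abs set_integral_diff(1) cK\<close>)
  then show ?thesis unfolding near_const_def set_integral_const_lmeasurable[OF assms(1)] by blast
qed

text \<open>If a \<le> b / 2, then b is at most 2 * (b - a) and the integral bound is already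
  proportional to the length of the interval. Otherwise \<open>g\<close> is at least
  \<open>g a\<close> on (0, a), with a > b / 2, so the integral bound forces g a - g b \<le> 2 * A
  and monotonicity finishes. The value at \<open>L\<close> is included in \<open>anti\<close>
  because b = L is allowed.\<close>

lemma near_const_left:
  fixes g :: "real \<Rightarrow> real"
  assumes g: "set_integrable lebesgue {0<..<L} g"
    and anti: "\<And>s t. 0 < s \<Longrightarrow> s \<le> t \<Longrightarrow> t \<le> L \<Longrightarrow> g t \<le> g s"
    and ab: "0 \<le> a" "a < b" "b \<le> L" and A: "0 \<le> A"
    and int: "(LINT s:{0<..<L}|lebesgue. max 0 (g s - g b)) \<le> A * b"
  shows "near_const (2 * A) {a<..<b} g"
proof -
  have sub: "set_integrable lebesgue {u<..<v} g" if "0 \<le> u" "v \<le> L" for u v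
    using that by (intro set_integrable_subset[OF g]) auto
  have pos: "set_integrable lebesgue {0<..<L} (\<lambda>s. max 0 (g s - g b))"
    by (intro set_integrable_pos_part set_integral_diff(1) g set_integrable_const_lmeasurable) auto
  show ?thesis
  proof (cases "a \<le> b / 2")
    case True
    have "(LINT s:{a<..<b}|lebesgue. \<bar>g s - g b\<bar>) = (LINT s:{a<..<b}|lebesgue. max 0 (g s - g b))"
      by (rule set_lebesgue_integral_cong) (use anti ab in fastforce)+
    also have "\<dots> \<le> (LINT s:{0<..<L}|lebesgue. max 0 (g s - g b))"
      by (rule set_integral_mono_set[OF pos]) (use ab in auto)
    also have "\<dots> \<le> A * (2 * (b - a))" using int True A by (intro order_trans[OF int] mult_left_mono) auto
    finally show ?thesis using ab unfolding near_const_def by (intro exI[of _ "g b"]) (simp add: algebra_simps)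
  next
    case False
    have "(g a - g b) * a = (LINT s:{0<..<a}|lebesgue. g a - g b)"
      using ab by (subst set_integral_const_lmeasurable) auto
    also have "\<dots> \<le> (LINT s:{0<..<a}|lebesgue. max 0 (g s - g b))"
      by (rule set_integral_mono[OF set_integrable_const_lmeasurable set_integrable_subset[OF pos]])
        (use anti ab in \<open>auto intro!: max.coboundedI2\<close>)
    also have "\<dots> \<le> (LINT s:{0<..<L}|lebesgue. max 0 (g s - g b))"
      by (rule set_integral_mono_set[OF pos]) (use ab in auto)
    also have "\<dots> \<le> A * (2 * a)" using int False A by (intro order_trans[OF int] mult_left_mono) auto
    finally have "(g a - g b) * a \<le> 2 * A * a" by simp
    then have d: "g a - g b \<le> 2 * A" using False ab by (simp add: mult_le_cancel_right)
    show ?thesis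
    proof (rule near_const_bounded[where c = "g b"])
      fix x assume "x \<in> {a<..<b}"
      then have "g b \<le> g x" "g x \<le> g a" using anti[of a x] anti[of x b] ab False by auto
      then show "\<bar>g x - g b\<bar> \<le> 2 * A" using d by linarith
    qed (use sub ab in auto)
  qed
qed

text \<open>The mirror image of \<open>near_const_left\<close>: either L - a is comparable to b - a,
  or (b, L) makes up at least half of (a, L) and \<open>g\<close> is at most \<open>g b\<close>
  there. Now \<open>g a\<close> is the reference value, so \<open>a\<close> has to be
  positive.\<close>

lemma near_const_right:
  fixes g :: "real \<Rightarrow> real"
  assumes g: "set_integrable lebesgue {0<..<L} g"
    and anti: "\<And>s t. 0 < s \<Longrightarrow> s \<le> t \<Longrightarrow> t \<le> L \<Longrightarrow> g t \<le> g s"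
    and ab: "0 < a" "a < b" "b \<le> L" and A: "0 \<le> A"
    and int: "(LINT s:{0<..<L}|lebesgue. max 0 (g a - g s)) \<le> A * (L - a)"
  shows "near_const (2 * A) {a<..<b} g"
proof -
  have sub: "set_integrable lebesgue {u<..<v} g" if "0 \<le> u" "v \<le> L" for u v
    using that by (intro set_integrable_subset[OF g]) auto
  have pos: "set_integrable lebesgue {0<..<L} (\<lambda>s. max 0 (g a - g s))"
    by (intro set_integrable_pos_part set_integral_diff(1) g set_integrable_const_lmeasurable) auto
  show ?thesis
  proof (cases "L - a \<le> 2 * (b - a)")
    case True
    have "(LINT s:{a<..<b}|lebesgue. \<bar>g s - g a\<bar>) = (LINT s:{a<..<b}|lebesgue. max 0 (g a - g s))"
      by (rule set_lebesgue_integral_cong) (use anti ab in fastforce)+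
    also have "\<dots> \<le> (LINT s:{0<..<L}|lebesgue. max 0 (g a - g s))"
      by (rule set_integral_mono_set[OF pos]) (use ab in auto)
    also have "\<dots> \<le> A * (2 * (b - a))" using int True A by (intro order_trans[OF int] mult_left_mono) auto
    finally show ?thesis using ab unfolding near_const_def by (intro exI[of _ "g a"]) (simp add: algebra_simps)
  next
    case False
    then have bL: "L - b > 0" "L - a \<le> 2 * (L - b)" using ab by argo+
    have "(g a - g b) * (L - b) = (LINT s:{b<..<L}|lebesgue. g a - g b)"
      using ab bL by (subst set_integral_const_lmeasurable) auto
    also have "\<dots> \<le> (LINT s:{b<..<L}|lebesgue. max 0 (g a - g s))"
      by (rule set_integral_mono[OF set_integrable_const_lmeasurable set_integrable_subset[OF pos]])
        (use anti ab in \<open>auto intro!: max.coboundedI2\<close>)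
    also have "\<dots> \<le> (LINT s:{0<..<L}|lebesgue. max 0 (g a - g s))"
      by (rule set_integral_mono_set[OF pos]) (use ab in auto)
    also have "\<dots> \<le> A * (2 * (L - b))" using int bL A by (intro order_trans[OF int] mult_left_mono) auto
    finally have "(g a - g b) * (L - b) \<le> 2 * A * (L - b)" by (simp only: mult_ac)
    then have d: "g a - g b \<le> 2 * A" using bL by (simp add: mult_le_cancel_right)
    show ?thesis
    proof (rule near_const_bounded[where c = "g a"])
      fix x assume "x \<in> {a<..<b}"
      then have "g b \<le> g x" "g x \<le> g a" using anti[of a x] anti[of x b] ab by auto
      then show "\<bar>g x - g a\<bar> \<le> 2 * A" using d by linarith
    qed (use sub ab in auto)
  qed
qed

section \<open>Oscillation of equidistributed monotone functions\<close>

text \<open>Equality of push-forward measures transfers integrals as well as measures of level sets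
  between functions on different domains, here a rearrangement on an interval and the absolute value
  of a function on a cube. Measurability is included to make \<open>distr\<close>
  meaningful.\<close>

definition equidistributed :: "'a::euclidean_space set \<Rightarrow> ('a \<Rightarrow> real) \<Rightarrow> 'b::euclidean_space set \<Rightarrow> ('b \<Rightarrow> real) \<Rightarrow> bool" where
  "equidistributed S g T f \<longleftrightarrow> g \<in> borel_measurable (lebesgue_on S) \<and> f \<in> borel_measurable (lebesgue_on T) \<and>
     distr (lebesgue_on S) borel g = distr (lebesgue_on T) borel f"

lemma integral_distr_lebesgue_on:
  assumes S: "S \<in> sets lebesgue" and g: "g \<in> borel_measurable (lebesgue_on S)" and \<phi>: "\<phi> \<in> borel_measurable borel"
  shows "(LINT x|distr (lebesgue_on S) borel g. \<phi> x) = (LINT s:S|lebesgue. (\<phi> (g s) :: real))"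
    "integrable (distr (lebesgue_on S) borel g) \<phi> \<longleftrightarrow> set_integrable lebesgue S (\<lambda>s. \<phi> (g s))"
proof -
  have S': "S \<inter> space lebesgue \<in> sets lebesgue" using S by simp
  show "(LINT x|distr (lebesgue_on S) borel g. \<phi> x) = (LINT s:S|lebesgue. (\<phi> (g s) :: real))"
    by (simp add: integral_distr[OF g \<phi>] integral_restrict_space[OF S'] set_lebesgue_integral_def)
  show "integrable (distr (lebesgue_on S) borel g) \<phi> \<longleftrightarrow> set_integrable lebesgue S (\<lambda>s. \<phi> (g s))"
    by (simp add: integrable_distr_eq[OF g \<phi>] integrable_restrict_space[OF S'] set_integrable_def)
qed

lemma equidistributed_integral:
  assumes "equidistributed S g T f" "S \<in> sets lebesgue" "T \<in> sets lebesgue" and \<phi>: "\<phi> \<in> borel_measurable borel"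
  shows "(LINT s:S|lebesgue. (\<phi> (g s) :: real)) = (LINT x:T|lebesgue. \<phi> (f x))"
    "set_integrable lebesgue S (\<lambda>s. \<phi> (g s)) \<longleftrightarrow> set_integrable lebesgue T (\<lambda>x. \<phi> (f x))"
  using assms integral_distr_lebesgue_on[OF _ _ \<phi>] unfolding equidistributed_def by metis+

lemma equidistributed_measure:
  assumes e: "equidistributed S g T f" and S: "S \<in> sets lebesgue" and T: "T \<in> sets lebesgue" and B: "B \<in> sets borel"
  shows "measure lebesgue {s \<in> S. g s \<in> B} = measure lebesgue {x \<in> T. f x \<in> B}"
proof -
  have *: "measure (distr (lebesgue_on S) borel g) B = measure lebesgue {s \<in> S. g s \<in> B}"
    if "S \<in> sets lebesgue" "g \<in> borel_measurable (lebesgue_on S)" for S and g :: "'c::euclidean_space \<Rightarrow> real"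
  proof -
    have "measure (distr (lebesgue_on S) borel g) B = measure (lebesgue_on S) (g -` B \<inter> S)"
      using that B by (simp add: measure_distr)
    also have "\<dots> = measure lebesgue (g -` B \<inter> S)"
      using that by (intro measure_restrict_space) auto
    also have "g -` B \<inter> S = {s \<in> S. g s \<in> B}" by auto
    finally show ?thesis .
  qed
  show ?thesis using *[OF S] *[OF T] e unfolding equidistributed_def by metis
qed

lemma near_const_uminus: "near_const e K f \<Longrightarrow> near_const e K (\<lambda>x. - f x)"
proof -
  assume "near_const e K f"
  then obtain c where c: "(LINT x:K|lebesgue. \<bar>f x - c\<bar>) \<le> e * measure lebesgue K" by (auto simp: near_const_def)
  have "\<bar>- f x - - c\<bar> = \<bar>f x - c\<bar>" for x by linarith
  then show ?thesis using c unfolding near_const_def by (intro exI[of _ "- c"]) simp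
qed

text \<open>On the low set |f - c| is at least c - \<beta>, on the high set at least \<alpha> - c.
  For \<beta> < \<alpha> the two sets are disjoint, and adding the contributions cancels
  \<open>c\<close>: 3/8 * (\<alpha> - \<beta>) is at most \<open>e\<close>.\<close>

lemma gap_le_oscillation:
  fixes f :: "'a::euclidean_space \<Rightarrow> real"
  assumes K: "K \<in> lmeasurable" "measure lebesgue K > 0" and f: "set_integrable lebesgue K f" and near: "near_const e K f"
    and low: "measure lebesgue {x \<in> K. f x \<le> \<beta>} \<ge> 3/8 * measure lebesgue K"
    and high: "measure lebesgue {x \<in> K. f x \<ge> \<alpha>} \<ge> 3/8 * measure lebesgue K"
  shows "\<alpha> - \<beta> \<le> 4 * e"
proof -
  obtain c where c: "(LINT x:K|lebesgue. \<bar>f x - c\<bar>) \<le> e * measure lebesgue K"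
    using near by (auto simp: near_const_def)
  have e0: "e \<ge> 0" using near_const_nonneg[OF near K(2)] .
  show ?thesis
  proof (cases "\<beta> < \<alpha>")
    case True
    have Ks: "K \<in> sets lebesgue" using K by auto
    define A where "A = {x \<in> K. f x \<le> \<beta>}"
    define B where "B = {x \<in> K. f x \<ge> \<alpha>}"
    have As: "A \<in> sets lebesgue" "B \<in> sets lebesgue"
      using set_integrable_level_set[OF f Ks, of "{..\<beta>}"] set_integrable_level_set[OF f Ks, of "{\<alpha>..}"]
      by (auto simp: A_def B_def)
    then have Am: "A \<in> lmeasurable" "B \<in> lmeasurable"
      using K by (auto intro!: fmeasurableI2[OF K(1)] simp: A_def B_def)
    have osc: "set_integrable lebesgue K (\<lambda>x. \<bar>f x - c\<bar>)"
      by (intro set_integrable_abs set_integral_diff(1) f set_integrable_const_lmeasurable K)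
    have sub: "set_integrable lebesgue A (\<lambda>x. \<bar>f x - c\<bar>)" "set_integrable lebesgue B (\<lambda>x. \<bar>f x - c\<bar>)"
      using As by (auto intro!: set_integrable_subset[OF osc] simp: A_def B_def)
    have "(c - \<beta>) * measure lebesgue A = (LINT x:A|lebesgue. c - \<beta>)"
      by (rule set_integral_const_lmeasurable[OF Am(1), symmetric])
    also have "\<dots> \<le> (LINT x:A|lebesgue. \<bar>f x - c\<bar>)"
      by (rule set_integral_mono[OF set_integrable_const_lmeasurable[OF Am(1)] sub(1)]) (auto simp: A_def)
    finally have 1: "(c - \<beta>) * measure lebesgue A \<le> (LINT x:A|lebesgue. \<bar>f x - c\<bar>)" .
    have "(\<alpha> - c) * measure lebesgue B = (LINT x:B|lebesgue. \<alpha> - c)"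
      by (rule set_integral_const_lmeasurable[OF Am(2), symmetric])
    also have "\<dots> \<le> (LINT x:B|lebesgue. \<bar>f x - c\<bar>)"
      by (rule set_integral_mono[OF set_integrable_const_lmeasurable[OF Am(2)] sub(2)]) (auto simp: B_def)
    finally have 2: "(\<alpha> - c) * measure lebesgue B \<le> (LINT x:B|lebesgue. \<bar>f x - c\<bar>)" .
    have "(LINT x:A|lebesgue. \<bar>f x - c\<bar>) + (LINT x:B|lebesgue. \<bar>f x - c\<bar>) = (LINT x:A \<union> B|lebesgue. \<bar>f x - c\<bar>)"
      using True by (intro set_integral_Un[symmetric] sub) (auto simp: A_def B_def)
    also have "\<dots> \<le> (LINT x:K|lebesgue. \<bar>f x - c\<bar>)"
      using As by (intro set_integral_mono_set[OF osc]) (auto simp: A_def B_def)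
    finally have 3: "(LINT x:A|lebesgue. \<bar>f x - c\<bar>) + (LINT x:B|lebesgue. \<bar>f x - c\<bar>) \<le> e * measure lebesgue K"
      using c by linarith
    have nn: "0 \<le> (LINT x:A|lebesgue. \<bar>f x - c\<bar>)" "0 \<le> (LINT x:B|lebesgue. \<bar>f x - c\<bar>)"
      unfolding set_lebesgue_integral_def by (intro integral_nonneg_AE; auto)+
    \<comment> \<open>The lower bound on the measure of \<open>A\<close> may only be multiplied by a
      nonnegative factor; when \<open>c\<close> lies below \<beta> the left side is nonpositive and
      the bound is trivial. The same applies to \<open>b\<close>.\<close>
    have a: "(c - \<beta>) * (3/8 * measure lebesgue K) \<le> (LINT x:A|lebesgue. \<bar>f x - c\<bar>)"
    proof (cases "c - \<beta> \<ge> 0")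
      case True
      then show ?thesis using mult_left_mono[OF low True] 1 by (simp add: A_def)
    next
      case False
      then have "(c - \<beta>) * (3/8 * measure lebesgue K) \<le> 0" using K by (simp add: mult_nonpos_nonneg)
      then show ?thesis using nn by linarith
    qed
    have b: "(\<alpha> - c) * (3/8 * measure lebesgue K) \<le> (LINT x:B|lebesgue. \<bar>f x - c\<bar>)"
    proof (cases "\<alpha> - c \<ge> 0")
      case True
      then show ?thesis using mult_left_mono[OF high True] 2 by (simp add: B_def)
    next
      case False
      then have "(\<alpha> - c) * (3/8 * measure lebesgue K) \<le> 0" using K by (simp add: mult_nonpos_nonneg)
      then show ?thesis using nn by linarith
    qed
    have "((\<alpha> - \<beta>) * (3/8)) * measure lebesgue K \<le> e * measure lebesgue K"
      using a b 3 by (simp add: algebra_simps)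
    then have "(\<alpha> - \<beta>) * (3/8) \<le> e" using K(2) by (simp add: mult_le_cancel_right)
    then have "\<alpha> - \<beta> \<le> 8/3 * e" by (simp add: field_simps)
    then show ?thesis using e0 by linarith
  qed (use e0 in linarith)
qed

text \<open>The local estimate, by cases on the density in the cubes of \<open>D\<close> of the
  level set \<open>G\<close> above \<open>g b\<close>. The bound on b - a makes \<open>G\<close> and
  the level set \<open>E\<close> above \<open>g a\<close> differ by at most one eighth of a cube, so
  density 1/2 for \<open>G\<close> leaves at least 3/8 for \<open>E\<close>, and at most 5/8 for its
  complement.\<close>

lemma equidistributed_osc:
  fixes f :: "'a::euclidean_space \<Rightarrow> real" and g :: "real \<Rightarrow> real"
  assumes Q: "is_cube Q" and L: "L = measure lebesgue Q"
    and f: "set_integrable lebesgue Q f"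
    and eq: "equidistributed {0<..<L} g Q f"
    and anti: "\<And>s t. 0 < s \<Longrightarrow> s \<le> t \<Longrightarrow> t \<le> L \<Longrightarrow> g t \<le> g s"
    and D: "finite D" "disjoint D" "negligible (Q - \<Union>D)" "D \<subseteq> subcubes Q"
    and Dbox: "\<And>K. K \<in> D \<Longrightarrow> \<exists>y. K = box y (y + r *\<^sub>R One)" and r: "r > 0"
    and near: "\<And>K. K \<in> subcubes Q \<Longrightarrow> measure lebesgue K \<le> r ^ DIM('a) \<Longrightarrow> near_const e K f"
    and ab: "0 \<le> a" "a < b" "b \<le> L" "8 * (b - a) \<le> r ^ DIM('a)"
  shows "near_const (2 ^ (DIM('a) + 4) * e) {a<..<b} g"
proof -
  note Qm = is_cube_lmeasurable[OF Q]
  then have Qs: "Q \<in> sets lebesgue" by auto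
  define q where "q = r ^ DIM('a)"
  have q: "q > 0" using r by (simp add: q_def)
  have Is: "{0<..<L} \<in> sets lebesgue" by simp
  note emeas = equidistributed_measure[OF eq Is Qs]
  note eint = equidistributed_integral[OF eq Is Qs]
  have g: "set_integrable lebesgue {0<..<L} g" using eint(2)[of "\<lambda>x. x"] f by simp
  define C where "C = 2 ^ (DIM('a) + 3) * e"
  have boxm: "measure lebesgue (box y (y + r *\<^sub>R One)) = q" for y :: 'a using measure_cube[OF r] by (simp only: q_def)
  have boxsub: "box y (y + r *\<^sub>R One) \<in> subcubes Q" if "box y (y + r *\<^sub>R One) \<subseteq> Q" for y
    using that r by (auto simp: subcubes_def is_cube_def)
  have Kq: "measure lebesgue K = q" "K \<in> lmeasurable" "K \<subseteq> Q" if "K \<in> D" for K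
    using Dbox[OF that] boxm D(4) that is_cube_lmeasurable[of K] by (auto simp: subcubes_def)
  have sub_near: "near_const e J f" if "K \<in> D" "J \<in> subcubes K" for J K
  proof (rule near)
    have "J \<subseteq> K" "is_cube J" using that by (auto simp: subcubes_def)
    then show "J \<in> subcubes Q" using Kq[OF that(1)] by (auto simp: subcubes_def)
    show "measure lebesgue J \<le> r ^ DIM('a)"
      using measure_mono_fmeasurable[OF \<open>J \<subseteq> K\<close> _ Kq(2)[OF that(1)]] is_cube_lmeasurable[OF \<open>is_cube J\<close>] Kq(1)[OF that(1)]
      by (auto simp: q_def)
  qed
  define G where "G = {x \<in> Q. f x > g b}"
  define E where "E = {x \<in> Q. f x \<ge> g a}"
  have GEs: "G \<in> sets lebesgue" "E \<in> sets lebesgue"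
    using set_integrable_level_set[OF f Qs, of "{g b<..}"] set_integrable_level_set[OF f Qs, of "{g a..}"]
    by (auto simp: G_def E_def)
  then have GEm: "G \<in> lmeasurable" "E \<in> lmeasurable"
    by (auto intro!: fmeasurableI2[OF Qm] simp: G_def E_def)
  \<comment> \<open>The strict inequality in \<open>G\<close> and the weak one in \<open>E\<close>
    take care of plateaus of \<open>g\<close>: \<open>g\<close> exceeds \<open>g b\<close> only to
    the left of \<open>b\<close>, and is at least \<open>g a\<close> on all of (0, a).\<close>
  have Gb: "measure lebesgue G \<le> b"
  proof -
    have "measure lebesgue G = measure lebesgue {s \<in> {0<..<L}. g s \<in> {g b<..}}" by (subst emeas) (auto simp: G_def)
    also have "\<dots> \<le> measure lebesgue {0<..<b}"
    proof (rule measure_mono_fmeasurable)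
      show "{s \<in> {0<..<L}. g s \<in> {g b<..}} \<subseteq> {0<..<b}"
      proof
        fix s assume s: "s \<in> {s \<in> {0<..<L}. g s \<in> {g b<..}}"
        then have "\<not> b \<le> s" using anti[of b s] ab by auto
        then show "s \<in> {0<..<b}" using s by auto
      qed
    qed (use set_integrable_level_set[OF g Is, of "{g b<..}"] in auto)
    finally show ?thesis using ab by simp
  qed
  have Ea: "a \<le> measure lebesgue E"
  proof -
    have "a = measure lebesgue {0<..<a}" using ab by simp
    also have "\<dots> \<le> measure lebesgue {s \<in> {0<..<L}. g s \<in> {g a..}}"
    proof (rule measure_mono_fmeasurable)
      show "{0<..<a} \<subseteq> {s \<in> {0<..<L}. g s \<in> {g a..}}" using anti[of _ a] ab by auto
      show "{s \<in> {0<..<L}. g s \<in> {g a..}} \<in> lmeasurable"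
        by (rule fmeasurableI2[of "{0<..<L}"]) (use set_integrable_level_set[OF g Is, of "{g a..}"] in auto)
    qed auto
    also have "\<dots> = measure lebesgue E" by (subst emeas) (auto simp: E_def)
    finally show ?thesis .
  qed
  have GE: "measure lebesgue (G - E) \<le> q / 8" if "0 < a" "g b < g a"
  proof -
    have "E \<subseteq> G" using that by (auto simp: E_def G_def)
    then have "measure lebesgue (G - E) = measure lebesgue G - measure lebesgue E"
      using GEm GEs by (intro measurable_measure_Diff) auto
    then show ?thesis using Gb Ea ab by (simp add: q_def)
  qed
  \<comment> \<open>This also settles the case without a gap, g a \<le> g b, where \<open>g\<close>
    is constant on the interval.\<close>
  have Ibd: "near_const k {a<..<b} g" if "0 \<le> k" "0 < a" "g a - g b \<le> k" for k
  proof (rule near_const_bounded[where c = "g b"])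
    fix x assume "x \<in> {a<..<b}"
    then have "g b \<le> g x" "g x \<le> g a" using anti[of a x] anti[of x b] ab that by auto
    then show "\<bar>g x - g b\<bar> \<le> k" using that by linarith
  qed (use ab in \<open>auto intro!: set_integrable_subset[OF g]\<close>)
  have "D \<noteq> {}"
  proof
    assume "D = {}"
    then have "negligible Q" using D(3) by simp
    then show False using is_cube_measure_pos[OF Q] by (simp add: negligible_imp_measure0)
  qed
  then obtain K0 where K0: "K0 \<in> D" by auto
  have e0: "e \<ge> 0"
    using near[of K0] near_const_nonneg[of e K0 f] D(4) K0 Kq(1)[OF K0] q by (auto simp: q_def)
  have C0: "C \<ge> 0" and C4: "4 * e \<le> 2 * C"
  proof -
    show "C \<ge> 0" using e0 by (simp add: C_def)
    have "1 \<le> (2::real) ^ DIM('a)" by simp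
    then have "e * 1 \<le> e * 2 ^ DIM('a)" using e0 by (rule mult_left_mono)
    then show "4 * e \<le> 2 * C" using e0 by (simp add: C_def power_add)
  qed
  have dens_le: "measure lebesgue (A \<inter> K) \<le> measure lebesgue A" if "A \<in> lmeasurable" "K \<in> D" for A K
    using that Kq(2) by (intro measure_mono_fmeasurable) auto
  \<comment> \<open>In the mixed case a cube translated from \<open>K1\<close> to \<open>K2\<close> meets \<open>G\<close> in exactly half its measure
    on the way; \<open>G - E\<close> is too small to separate \<open>E\<close> from the complement of \<open>G\<close> inside that cube.\<close>
  consider (small) "\<And>K. K \<in> D \<Longrightarrow> measure lebesgue (G \<inter> K) \<le> q / 2"
    | (big) "\<And>K. K \<in> D \<Longrightarrow> measure lebesgue (G \<inter> K) \<ge> q / 2"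
    | (mixed) K1 K2 where "K1 \<in> D" "K2 \<in> D" "measure lebesgue (G \<inter> K1) < q / 2" "measure lebesgue (G \<inter> K2) > q / 2"
    by (meson linear not_le)
  then have "near_const (2 * C) {a<..<b} g"
  proof cases
    case small
    have "measure lebesgue {x \<in> K. f x > g b} \<le> 5/8 * measure lebesgue K" if "K \<in> D" for K
    proof -
      have "{x \<in> K. f x > g b} = G \<inter> K" using Kq(3)[OF that] by (auto simp: G_def)
      then show ?thesis using small[OF that] Kq(1)[OF that] q by simp
    qed
    then have "(LINT x:Q|lebesgue. max 0 (f x - g b)) \<le> C * measure lebesgue G"
      unfolding C_def G_def by (intro calderon_zygmund_grid[OF Q f D sub_near]) auto
    also have "\<dots> \<le> C * b" using Gb C0 by (rule mult_left_mono)
    finally have "(LINT s:{0<..<L}|lebesgue. max 0 (g s - g b)) \<le> C * b"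
      using eint(1)[of "\<lambda>y. max 0 (y - g b)"] by simp
    then show ?thesis by (intro near_const_left[OF g anti ab(1-3) C0])
  next
    case big
    \<comment> \<open>A grid cube that is half filled by \<open>G\<close> forces b \<ge> q / 2,
      while b - a \<le> q / 8. Hence \<open>a\<close> is positive and \<open>g a\<close> may be
      used.\<close>
    have "q / 2 \<le> b" using big[OF K0] dens_le[OF GEm(1) K0] Gb by linarith
    then have a0: "0 < a" using ab q by (auto simp: q_def)
    show ?thesis
    proof (cases "g b < g a")
      case True
      \<comment> \<open>The superlevel set of \<open>- f\<close> in \<open>K\<close> is the
        complement of \<open>E\<close>. It is covered by \<open>K - G\<close>, of measure at most q
        / 2, and \<open>G - E\<close>, of measure at most q / 8; together 5/8 of the cube.\<close>
      have "measure lebesgue {x \<in> K. - f x > - g a} \<le> 5/8 * measure lebesgue K" if K: "K \<in> D" for K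
      proof -
        have "{x \<in> K. - f x > - g a} = K - E" using Kq(3)[OF K] by (auto simp: E_def)
        also have "measure lebesgue (K - E) \<le> measure lebesgue ((K - G) \<union> (G - E))"
          using Kq(2)[OF K] GEs GEm by (intro measure_mono_fmeasurable) auto
        also have "\<dots> \<le> measure lebesgue (K - G) + measure lebesgue (G - E)"
          using Kq(2)[OF K] GEs by (intro measure_Un_le) auto
        also have "\<dots> \<le> q / 2 + q / 8"
          using measure_Int_Diff[OF Kq(2)[OF K] GEs(1)] big[OF K] Kq(1)[OF K] GE[OF a0 True]
          by (simp add: Int_commute)
        finally show ?thesis using Kq(1)[OF K] by simp
      qed
      then have "(LINT x:Q|lebesgue. max 0 (- f x - (- g a))) \<le> C * measure lebesgue {x \<in> Q. - f x > - g a}"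
        unfolding C_def
        by (intro calderon_zygmund_grid[OF Q _ D near_const_uminus[OF sub_near]])
          (use f in \<open>auto simp: set_integrable_def\<close>)
      also have "{x \<in> Q. - f x > - g a} = Q - E" by (auto simp: E_def)
      also have "measure lebesgue (Q - E) = L - measure lebesgue E"
        unfolding L using Qm GEs by (intro measurable_measure_Diff) (auto simp: E_def)
      also have "C * (L - measure lebesgue E) \<le> C * (L - a)" using Ea C0 by (intro mult_left_mono) auto
      finally have "(LINT s:{0<..<L}|lebesgue. max 0 (g a - g s)) \<le> C * (L - a)"
        using eint(1)[of "\<lambda>y. max 0 (g a - y)"] by simp
      then show ?thesis by (intro near_const_right[OF g anti a0 ab(2,3) C0])
    qed (use Ibd[of "2 * C"] C0 a0 in auto)
  next
    case mixed
    have "q / 2 \<le> b" using mixed(4) dens_le[OF GEm(1) mixed(2)] Gb by linarith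
    then have a0: "0 < a" using ab q by (auto simp: q_def)
    show ?thesis
    proof (cases "g b < g a")
      case True
      obtain y1 y2 where y: "K1 = box y1 (y1 + r *\<^sub>R One)" "K2 = box y2 (y2 + r *\<^sub>R One)"
        using Dbox mixed by meson
      have "convex Q" using Q by (auto simp: is_cube_def)
      then obtain w where w: "box w (w + r *\<^sub>R One) \<subseteq> Q" "measure lebesgue (G \<inter> box w (w + r *\<^sub>R One)) = q / 2"
        using cube_of_prescribed_density[OF GEm(1), of Q y1 r y2 "q / 2"] mixed y Kq(3) by (metis less_imp_le)
      define K where "K = box w (w + r *\<^sub>R One)"
      have K: "K \<in> lmeasurable" "measure lebesgue K = q" "K \<subseteq> Q" "measure lebesgue (G \<inter> K) = q / 2"
        using boxm[of w] w by (auto simp: K_def)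
      have "g a - g b \<le> 4 * e"
      proof (rule gap_le_oscillation[OF K(1)])
        show "near_const e K f" using boxsub[OF w(1)] K(2) by (intro near) (auto simp: K_def q_def)
        show "set_integrable lebesgue K f" using K by (intro set_integrable_subset[OF f]) auto
        have "{x \<in> K. f x \<le> g b} = K - G" using K(3) by (auto simp: G_def)
        then show "3/8 * measure lebesgue K \<le> measure lebesgue {x \<in> K. f x \<le> g b}"
          using measure_Int_Diff[OF K(1) GEs(1)] K(2,4) q by (simp add: Int_commute)
        have KE: "{x \<in> K. f x \<ge> g a} = K \<inter> E" using K(3) by (auto simp: E_def)
        have "measure lebesgue (G \<inter> K) \<le> measure lebesgue ((K \<inter> E) \<union> (G - E))"
          using K(1) GEs GEm by (intro measure_mono_fmeasurable fmeasurable.Un fmeasurable_Int_fmeasurable fmeasurable.Diff) auto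
        also have "\<dots> \<le> measure lebesgue (K \<inter> E) + measure lebesgue (G - E)"
          using K(1) GEs by (intro measure_Un_le) auto
        finally show "3/8 * measure lebesgue K \<le> measure lebesgue {x \<in> K. f x \<ge> g a}"
          unfolding KE using GE[OF a0 True] K(2,4) by simp
      qed (use K q in auto)
      then show ?thesis using C4 C0 a0 by (intro Ibd) auto
    qed (use Ibd[of "2 * C"] C0 a0 in auto)
  qed
  then show ?thesis by (simp add: C_def power_add mult_ac)
qed

section \<open>The decreasing rearrangement\<close>

context
  fixes Q :: "'a::euclidean_space set" and f :: "'a \<Rightarrow> real"
  assumes Q: "Q \<in> lmeasurable" and f: "set_integrable lebesgue Q f"
begin

lemma level_lmeasurable: "{x \<in> Q. \<bar>f x\<bar> > \<alpha>} \<in> lmeasurable"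
proof (rule fmeasurableI2[OF Q])
  have "{x \<in> Q. \<bar>f x\<bar> \<in> {\<alpha><..}} \<in> sets lebesgue"
    by (rule set_integrable_level_set[OF set_integrable_abs[OF f]]) (use Q in auto)
  then show "{x \<in> Q. \<bar>f x\<bar> > \<alpha>} \<in> sets lebesgue" by simp
qed auto

lemma distr_fun_antimono: "\<alpha> \<le> \<beta> \<Longrightarrow> distr_fun Q f \<beta> \<le> distr_fun Q f \<alpha>"
  unfolding distr_fun_def using level_lmeasurable by (intro measure_mono_fmeasurable) auto

lemma distr_fun_le: "distr_fun Q f \<alpha> \<le> measure lebesgue Q"
  unfolding distr_fun_def using level_lmeasurable Q by (intro measure_mono_fmeasurable) auto

lemma distr_fun_tendsto_0: "(\<lambda>k. distr_fun Q f (real k)) \<longlonglongrightarrow> 0"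
proof -
  have "(\<lambda>k. measure lebesgue {x \<in> Q. \<bar>f x\<bar> > real k}) \<longlonglongrightarrow> measure lebesgue (\<Inter>k. {x \<in> Q. \<bar>f x\<bar> > real k})"
  proof (rule Lim_measure_decseq)
    show "decseq (\<lambda>k. {x \<in> Q. \<bar>f x\<bar> > real k})" by (rule decseq_SucI) auto
    show "emeasure lebesgue {x \<in> Q. \<bar>f x\<bar> > real i} \<noteq> \<infinity>" for i
      using level_lmeasurable[of "real i"] by (simp add: emeasure_eq_measure2)
  qed (use level_lmeasurable in auto)
  moreover have "(\<Inter>k. {x \<in> Q. \<bar>f x\<bar> > real k}) = {}"
  proof -
    have "\<exists>k. \<bar>f x\<bar> \<le> real k" for x using real_arch_simple by blast
    then show ?thesis by (simp add: set_eq_iff not_less)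
  qed
  ultimately show ?thesis by (simp add: distr_fun_def)
qed

text \<open>The level set above \<alpha> is the increasing union of those above \<alpha> + 1 / (k +
  1). This right continuity keeps the supremum of the levels in \<open>decr_rearr\<close> from being
  attained.\<close>

lemma distr_fun_right_continuous:
  assumes "distr_fun Q f \<alpha> > s" obtains \<beta> where "\<beta> > \<alpha>" "distr_fun Q f \<beta> > s"
proof -
  define A where "A k = {x \<in> Q. \<bar>f x\<bar> > \<alpha> + 1 / real (Suc k)}" for k
  have "(\<Union>k. A k) = {x \<in> Q. \<bar>f x\<bar> > \<alpha>}"
  proof (intro equalityI subsetI)
    fix x assume x: "x \<in> {x \<in> Q. \<bar>f x\<bar> > \<alpha>}"
    then obtain k where "1 / real (Suc k) < \<bar>f x\<bar> - \<alpha>" using nat_approx_posE[of "\<bar>f x\<bar> - \<alpha>"] by auto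
    then have "x \<in> A k" using x by (simp add: A_def less_diff_eq add.commute)
    then show "x \<in> (\<Union>k. A k)" by blast
  next
    fix x assume "x \<in> (\<Union>k. A k)"
    then obtain k where k: "x \<in> Q" "\<bar>f x\<bar> > \<alpha> + 1 / real (Suc k)" by (auto simp: A_def)
    have "1 / real (Suc k) > 0" by simp
    then have "\<bar>f x\<bar> > \<alpha>" using k(2) by linarith
    then show "x \<in> {x \<in> Q. \<bar>f x\<bar> > \<alpha>}" using k(1) by simp
  qed
  moreover have "(\<lambda>k. measure lebesgue (A k)) \<longlonglongrightarrow> measure lebesgue (\<Union>k. A k)"
  proof (rule Lim_measure_incseq)
    show "range A \<subseteq> sets lebesgue" using level_lmeasurable by (auto simp: A_def)
    show "incseq A"
    proof (rule incseq_SucI)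
      fix k
      have "1 / real (Suc (Suc k)) \<le> 1 / real (Suc k)" by (simp add: field_simps)
      show "A k \<subseteq> A (Suc k)"
      proof
        fix x assume "x \<in> A k"
        then show "x \<in> A (Suc k)"
          using \<open>1 / real (Suc (Suc k)) \<le> 1 / real (Suc k)\<close> unfolding A_def mem_Collect_eq by linarith
      qed
    qed
    show "emeasure lebesgue (\<Union>k. A k) \<noteq> \<infinity>"
      unfolding \<open>(\<Union>k. A k) = {x \<in> Q. \<bar>f x\<bar> > \<alpha>}\<close> using level_lmeasurable[of \<alpha>] by (simp add: emeasure_eq_measure2)
  qed
  ultimately have "(\<lambda>k. measure lebesgue (A k)) \<longlonglongrightarrow> distr_fun Q f \<alpha>" by (simp add: distr_fun_def)
  then have "\<forall>\<^sub>F k in sequentially. measure lebesgue (A k) > s" using assms order_tendstoD(1) by blast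
  then obtain k where "measure lebesgue (A k) > s" by (auto simp: eventually_sequentially)
  then show thesis by (intro that[of "\<alpha> + 1 / real (Suc k)"]) (auto simp: distr_fun_def A_def)
qed

text \<open>The levels whose distribution function exceeds \<open>s\<close> form an interval
  starting at 0 when there are any, bounded because the distribution function tends to 0; its
  measure is its length. Right continuity excludes the upper end point, which is what makes the
  equivalence exact with strict inequalities.\<close>

lemma decr_rearr_gt_iff:
  assumes "s > 0" "\<alpha> \<ge> 0"
  shows "decr_rearr Q f s > \<alpha> \<longleftrightarrow> distr_fun Q f \<alpha> > s"
proof -
  define A where "A = {\<alpha>. \<alpha> \<ge> 0 \<and> distr_fun Q f \<alpha> > s}"
  have down: "\<alpha> \<in> A" if "\<beta> \<in> A" "0 \<le> \<alpha>" "\<alpha> \<le> \<beta>" for \<alpha> \<beta>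
    using that distr_fun_antimono[of \<alpha> \<beta>] by (auto simp: A_def)
  obtain M :: nat where "distr_fun Q f (real M) < s"
    using order_tendstoD(2)[OF distr_fun_tendsto_0 assms(1)] by (auto simp: eventually_sequentially)
  then have M: "real M \<notin> A" by (simp add: A_def)
  have A0: "0 \<le> x" if "x \<in> A" for x using that by (simp add: A_def)
  have AM: "A \<subseteq> {0..real M}"
  proof
    fix x assume x: "x \<in> A"
    then show "x \<in> {0..real M}" using down[OF x, of "real M"] M A0[OF x] by fastforce
  qed
  have "is_interval A" unfolding is_interval_1 using down A0 by (meson order_trans)
  then have Am: "A \<in> lmeasurable"
    using AM bounded_subset[OF bounded_closed_interval AM]
    by (intro measurable_convex) (auto simp: is_interval_convex_1)
  have d: "decr_rearr Q f s = measure lebesgue A" by (simp add: decr_rearr_def A_def)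
  show ?thesis
  proof
    assume "distr_fun Q f \<alpha> > s"
    then obtain \<beta> where \<beta>: "\<beta> > \<alpha>" "distr_fun Q f \<beta> > s" by (rule distr_fun_right_continuous)
    then have "\<beta> \<in> A" using assms by (simp add: A_def)
    then have "{0..\<beta>} \<subseteq> A" using down by auto
    then have "measure lebesgue {0..\<beta>} \<le> measure lebesgue A" using Am by (intro measure_mono_fmeasurable) auto
    then show "decr_rearr Q f s > \<alpha>" using d \<beta> assms by simp
  next
    assume g: "decr_rearr Q f s > \<alpha>"
    show "distr_fun Q f \<alpha> > s"
    proof (rule ccontr)
      assume "\<not> ?thesis"
      then have "\<alpha> \<notin> A" by (simp add: A_def)
      have "A \<subseteq> {0..\<alpha>}"
      proof
        fix x assume x: "x \<in> A"
        then show "x \<in> {0..\<alpha>}" using down[OF x, of \<alpha>] \<open>\<alpha> \<notin> A\<close> assms A0[OF x] by fastforce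
      qed
      then have "measure lebesgue A \<le> measure lebesgue {0..\<alpha>}" using Am by (intro measure_mono_fmeasurable) auto
      then show False using g d assms by simp
    qed
  qed
qed

lemma decr_rearr_nonneg: "0 \<le> decr_rearr Q f s"
  by (simp add: decr_rearr_def)

lemma decr_rearr_antimono:
  assumes "0 < s" "s \<le> t"
  shows "decr_rearr Q f t \<le> decr_rearr Q f s"
proof (rule ccontr)
  assume "\<not> ?thesis"
  then have *: "decr_rearr Q f s < decr_rearr Q f t" by simp
  then have "t < distr_fun Q f (decr_rearr Q f s)"
    using decr_rearr_gt_iff[of t "decr_rearr Q f s"] assms decr_rearr_nonneg by simp
  then show False using decr_rearr_gt_iff[of s "decr_rearr Q f s"] assms decr_rearr_nonneg by simp
qed

lemma decr_rearr_level:
  "{s \<in> {0<..<measure lebesgue Q}. decr_rearr Q f s > \<alpha>}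
    = (if \<alpha> \<ge> 0 then {0<..<distr_fun Q f \<alpha>} else {0<..<measure lebesgue Q})"
proof (cases "\<alpha> \<ge> 0")
  case True
  then show ?thesis using decr_rearr_gt_iff[of _ \<alpha>] less_le_trans[OF _ distr_fun_le[of \<alpha>]] by auto
next
  case False
  then have "decr_rearr Q f s > \<alpha>" for s using decr_rearr_nonneg[of s] by linarith
  then show ?thesis using False by auto
qed

text \<open>Both push-forward measures are finite on the rays above any real \<alpha> and agree
  there, which determines them. For negative \<alpha> both rays carry the full measure of
  \<open>Q\<close>.\<close>

lemma equidistributed_decr_rearr:
  "equidistributed {0<..<measure lebesgue Q} (decr_rearr Q f) Q (\<lambda>x. \<bar>f x\<bar>)"
proof -
  let ?S = "{0<..<measure lebesgue Q}" and ?g = "decr_rearr Q f"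
  have Qs: "Q \<in> sets lebesgue" using Q by auto
  have gm: "?g \<in> borel_measurable (lebesgue_on ?S)"
    unfolding borel_measurable_iff_greater
  proof
    fix \<alpha>
    have "{0<..<distr_fun Q f \<alpha>} \<subseteq> ?S" using distr_fun_le[of \<alpha>] by auto
    then have "{s \<in> ?S. ?g s > \<alpha>} \<in> sets (lebesgue_on ?S)"
      unfolding decr_rearr_level by (simp add: sets_restrict_space_iff)
    then show "{s \<in> space (lebesgue_on ?S). \<alpha> < ?g s} \<in> sets (lebesgue_on ?S)" by simp
  qed
  have "(\<lambda>x. indicator Q x *\<^sub>R f x) \<in> borel_measurable lebesgue"
    using f unfolding set_integrable_def by blast
  then have "f \<in> borel_measurable (lebesgue_on Q)"
    using Qs by (subst borel_measurable_restrict_space_iff) auto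
  then have fm: "(\<lambda>x. \<bar>f x\<bar>) \<in> borel_measurable (lebesgue_on Q)" by simp
  have em: "emeasure (distr (lebesgue_on S) borel h) {\<alpha><..} = emeasure lebesgue {s \<in> S. h s > \<alpha>}"
    if "S \<in> sets lebesgue" "h \<in> borel_measurable (lebesgue_on S)" for S and h :: "'c::euclidean_space \<Rightarrow> real" and \<alpha>
  proof -
    have "emeasure (distr (lebesgue_on S) borel h) {\<alpha><..} = emeasure (lebesgue_on S) (h -` {\<alpha><..} \<inter> S)"
      using that by (simp add: emeasure_distr)
    also have "\<dots> = emeasure lebesgue (h -` {\<alpha><..} \<inter> S)"
      using that by (intro emeasure_restrict_space) auto
    also have "h -` {\<alpha><..} \<inter> S = {s \<in> S. h s > \<alpha>}" by auto
    finally show ?thesis .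
  qed
  have "distr (lebesgue_on ?S) borel ?g = distr (lebesgue_on Q) borel (\<lambda>x. \<bar>f x\<bar>)"
  proof (rule measure_eqI_lessThan)
    fix \<alpha> :: real
    have 1: "emeasure (distr (lebesgue_on ?S) borel ?g) {\<alpha><..} = emeasure lebesgue {s \<in> ?S. ?g s > \<alpha>}"
      by (rule em[OF _ gm]) simp
    show "emeasure (distr (lebesgue_on ?S) borel ?g) {\<alpha><..} < \<infinity>"
      unfolding 1 decr_rearr_level by (simp add: distr_fun_def)
    have 2: "emeasure (distr (lebesgue_on Q) borel (\<lambda>x. \<bar>f x\<bar>)) {\<alpha><..} = ennreal (measure lebesgue {x \<in> Q. \<bar>f x\<bar> > \<alpha>})"
      using em[OF Qs fm] level_lmeasurable[of \<alpha>] by (simp add: emeasure_eq_measure2)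
    have "\<alpha> < 0 \<Longrightarrow> {x \<in> Q. \<bar>f x\<bar> > \<alpha>} = Q" by force
    then show "emeasure (distr (lebesgue_on ?S) borel ?g) {\<alpha><..} = emeasure (distr (lebesgue_on Q) borel (\<lambda>x. \<bar>f x\<bar>)) {\<alpha><..}"
      unfolding 1 2 decr_rearr_level by (auto simp: distr_fun_def)
  qed auto
  then show ?thesis using gm fm by (simp add: equidistributed_def)
qed

lemma decr_rearr_integrable: "set_integrable lebesgue {0<..<measure lebesgue Q} (decr_rearr Q f)"
  and decr_rearr_integral:
    "(LINT s:{0<..<measure lebesgue Q}|lebesgue. decr_rearr Q f s) = (LINT x:Q|lebesgue. \<bar>f x\<bar>)"
  using equidistributed_integral[OF equidistributed_decr_rearr, of "\<lambda>x. x"] Q set_integrable_abs[OF f] by auto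

end

lemma decr_rearr_mono:
  assumes Q: "Q \<in> lmeasurable" and f: "set_integrable lebesgue Q f" and g: "set_integrable lebesgue Q g"
    and le: "\<And>x. x \<in> Q \<Longrightarrow> \<bar>f x\<bar> \<le> \<bar>g x\<bar>" and s: "s > 0"
  shows "decr_rearr Q f s \<le> decr_rearr Q g s"
proof (rule ccontr)
  assume "\<not> ?thesis"
  then have "s < distr_fun Q f (decr_rearr Q g s)"
    using decr_rearr_gt_iff[OF Q f s, of "decr_rearr Q g s"] decr_rearr_nonneg[OF Q g, of s] by simp
  also have "\<dots> \<le> distr_fun Q g (decr_rearr Q g s)"
    unfolding distr_fun_def using level_lmeasurable[OF Q f] level_lmeasurable[OF Q g] le
    by (intro measure_mono_fmeasurable) (auto dest: less_le_trans)
  finally show False using decr_rearr_gt_iff[OF Q g s, of "decr_rearr Q g s"] decr_rearr_nonneg[OF Q g, of s] by simp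
qed

text \<open>Comparing both rearrangements with the rearrangement of \<open>max \<bar>f\<bar> \<bar>g\<bar>\<close> reduces the
  contraction property to monotonicity and equimeasurability.\<close>

lemma decr_rearr_L1_contraction:
  assumes Q: "Q \<in> lmeasurable" and f: "set_integrable lebesgue Q f" and g: "set_integrable lebesgue Q g"
  shows "(LINT s:{0<..<measure lebesgue Q}|lebesgue. \<bar>decr_rearr Q f s - decr_rearr Q g s\<bar>)
    \<le> (LINT x:Q|lebesgue. \<bar>f x - g x\<bar>)"
proof -
  let ?S = "{0<..<measure lebesgue Q}"
  \<comment> \<open>This is the maximum of |f| and |g|, written with a positive part so that
    integrability follows from sums and differences.\<close>
  define h where "h x = \<bar>f x\<bar> + max 0 (\<bar>g x\<bar> - \<bar>f x\<bar>)" for x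
  have h: "set_integrable lebesgue Q h" unfolding h_def
    by (intro set_integral_add(1) set_integrable_pos_part set_integral_diff(1) set_integrable_abs f g)
  have hx: "\<bar>f x\<bar> \<le> \<bar>h x\<bar>" "\<bar>g x\<bar> \<le> \<bar>h x\<bar>" "2 * \<bar>h x\<bar> - \<bar>f x\<bar> - \<bar>g x\<bar> \<le> \<bar>f x - g x\<bar>" for x
  proof -
    have "h x = max \<bar>f x\<bar> \<bar>g x\<bar>" for x by (simp add: h_def max_def)
    then show "\<bar>f x\<bar> \<le> \<bar>h x\<bar>" "\<bar>g x\<bar> \<le> \<bar>h x\<bar>" "2 * \<bar>h x\<bar> - \<bar>f x\<bar> - \<bar>g x\<bar> \<le> \<bar>f x - g x\<bar>" for x
      using abs_triangle_ineq2[of "f x" "g x"] abs_triangle_ineq2_sym[of "g x" "f x"] by (auto simp: max_def)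
  qed
  note int = decr_rearr_integrable[OF Q f] decr_rearr_integrable[OF Q g] decr_rearr_integrable[OF Q h]
  note abs_int = set_integrable_abs[OF f] set_integrable_abs[OF g] set_integrable_abs[OF h]
  have 1: "set_integrable lebesgue ?S (\<lambda>s. 2 * decr_rearr Q h s - decr_rearr Q f s)"
    by (rule set_integral_diff(1)[OF set_integrable_mult_right[OF int(3)] int(1)])
  have 2: "set_integrable lebesgue Q (\<lambda>x. 2 * \<bar>h x\<bar> - \<bar>f x\<bar>)"
    by (rule set_integral_diff(1)[OF set_integrable_mult_right[OF abs_int(3)] abs_int(1)])
  have "(LINT s:?S|lebesgue. \<bar>decr_rearr Q f s - decr_rearr Q g s\<bar>)
      \<le> (LINT s:?S|lebesgue. 2 * decr_rearr Q h s - decr_rearr Q f s - decr_rearr Q g s)"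
  proof (rule set_integral_mono)
    show "\<bar>decr_rearr Q f s - decr_rearr Q g s\<bar> \<le> 2 * decr_rearr Q h s - decr_rearr Q f s - decr_rearr Q g s"
      if "s \<in> ?S" for s
      using that decr_rearr_mono[OF Q f h hx(1), of s] decr_rearr_mono[OF Q g h hx(2), of s] by auto
    show "set_integrable lebesgue ?S (\<lambda>s. \<bar>decr_rearr Q f s - decr_rearr Q g s\<bar>)"
      by (rule set_integrable_abs[OF set_integral_diff(1)[OF int(1,2)]])
    show "set_integrable lebesgue ?S (\<lambda>s. 2 * decr_rearr Q h s - decr_rearr Q f s - decr_rearr Q g s)"
      by (rule set_integral_diff(1)[OF 1 int(2)])
  qed
  also have "\<dots> = 2 * (LINT s:?S|lebesgue. decr_rearr Q h s) - (LINT s:?S|lebesgue. decr_rearr Q f s)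
      - (LINT s:?S|lebesgue. decr_rearr Q g s)"
    unfolding set_integral_diff(2)[OF 1 int(2)]
      set_integral_diff(2)[OF set_integrable_mult_right[OF int(3)] int(1)] by simp
  also have "\<dots> = 2 * (LINT x:Q|lebesgue. \<bar>h x\<bar>) - (LINT x:Q|lebesgue. \<bar>f x\<bar>) - (LINT x:Q|lebesgue. \<bar>g x\<bar>)"
    by (simp add: decr_rearr_integral[OF Q] f g h)
  also have "\<dots> = (LINT x:Q|lebesgue. 2 * \<bar>h x\<bar> - \<bar>f x\<bar> - \<bar>g x\<bar>)"
    unfolding set_integral_diff(2)[OF 2 abs_int(2)]
      set_integral_diff(2)[OF set_integrable_mult_right[OF abs_int(3)] abs_int(1)] by simp
  also have "\<dots> \<le> (LINT x:Q|lebesgue. \<bar>f x - g x\<bar>)"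
    by (rule set_integral_mono[OF set_integral_diff(1)[OF 2 abs_int(2)] set_integrable_abs[OF set_integral_diff(1)[OF f g]]])
      (rule hx(3))
  finally show ?thesis .
qed

section \<open>Continuity on BMO at VMO\<close>

lemma near_const_abs:
  assumes K: "K \<in> lmeasurable" and f: "set_integrable lebesgue K f" and near: "near_const e K f"
  shows "near_const e K (\<lambda>x. \<bar>f x\<bar>)"
proof -
  obtain c where c: "(LINT x:K|lebesgue. \<bar>f x - c\<bar>) \<le> e * measure lebesgue K"
    using near by (auto simp: near_const_def)
  note cK = set_integrable_const_lmeasurable[OF K]
  have "(LINT x:K|lebesgue. \<bar>\<bar>f x\<bar> - \<bar>c\<bar>\<bar>) \<le> (LINT x:K|lebesgue. \<bar>f x - c\<bar>)"
    by (rule set_integral_mono[OF set_integrable_abs[OF set_integral_diff(1)[OF set_integrable_abs[OF f] cK]]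
        set_integrable_abs[OF set_integral_diff(1)[OF f cK]]]) (rule abs_triangle_ineq3)
  then show ?thesis using c unfolding near_const_def by (intro exI[of _ "\<bar>c\<bar>"]) linarith
qed

lemma near_const_add:
  assumes K: "K \<in> lmeasurable" and f: "set_integrable lebesgue K f" "near_const e K f"
    and g: "set_integrable lebesgue K g" "near_const e' K g"
  shows "near_const (e + e') K (\<lambda>x. f x + g x)"
proof -
  obtain c where c: "(LINT x:K|lebesgue. \<bar>f x - c\<bar>) \<le> e * measure lebesgue K"
    using f by (auto simp: near_const_def)
  obtain d where d: "(LINT x:K|lebesgue. \<bar>g x - d\<bar>) \<le> e' * measure lebesgue K"
    using g by (auto simp: near_const_def)
  note cK = set_integrable_const_lmeasurable[OF K]
  note i = set_integrable_abs[OF set_integral_diff(1)[OF f(1) cK]] set_integrable_abs[OF set_integral_diff(1)[OF g(1) cK]]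
  have "(LINT x:K|lebesgue. \<bar>f x + g x - (c + d)\<bar>) \<le> (LINT x:K|lebesgue. \<bar>f x - c\<bar> + \<bar>g x - d\<bar>)"
    by (rule set_integral_mono[OF set_integrable_abs[OF set_integral_diff(1)[OF set_integral_add(1)[OF f(1) g(1)] cK]]
        set_integral_add(1)[OF i]]) linarith
  also have "\<dots> = (LINT x:K|lebesgue. \<bar>f x - c\<bar>) + (LINT x:K|lebesgue. \<bar>g x - d\<bar>)"
    by (rule set_integral_add(2)[OF i])
  also have "\<dots> \<le> (e + e') * measure lebesgue K" using c d by (simp add: distrib_right)
  finally show ?thesis unfolding near_const_def by blast
qed

lemma near_const_mono:
  assumes "near_const e K f" "e \<le> e'"
  shows "near_const e' K f"
proof -
  have "e * measure lebesgue K \<le> e' * measure lebesgue K" using assms(2) by (intro mult_right_mono) auto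
  then show ?thesis using assms(1) unfolding near_const_def by (meson order_trans)
qed

lemma near_const_mean_osc: "measure lebesgue K > 0 \<Longrightarrow> near_const (mean_osc f K) K f"
  unfolding near_const_def mean_osc_def by (intro exI[of _ "avg f K"]) simp

lemma mean_osc_nonneg: "0 \<le> mean_osc f K"
  unfolding mean_osc_def set_lebesgue_integral_def by (intro divide_nonneg_nonneg integral_nonneg_AE) auto

text \<open>The mean differs from any constant \<open>c\<close> by at most the average of |f - c|,
  so replacing \<open>c\<close> by the mean at most doubles the bound.\<close>

lemma mean_osc_le_near_const:
  assumes K: "K \<in> lmeasurable" "measure lebesgue K > 0" and f: "set_integrable lebesgue K f" and near: "near_const e K f"
  shows "mean_osc f K \<le> 2 * e"
proof -
  obtain c where c: "(LINT x:K|lebesgue. \<bar>f x - c\<bar>) \<le> e * measure lebesgue K"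
    using near by (auto simp: near_const_def)
  note cK = set_integrable_const_lmeasurable[OF K(1)]
  note i = set_integrable_abs[OF set_integral_diff(1)[OF f cK]]
  define A where "A = avg f K"
  have "(c - A) * measure lebesgue K = - (LINT x:K|lebesgue. f x - c)"
    using K by (simp add: set_integral_diff(2)[OF f cK] A_def avg_def set_integral_const_lmeasurable field_simps)
  then have "\<bar>c - A\<bar> * measure lebesgue K = \<bar>LINT x:K|lebesgue. f x - c\<bar>"
    using K by (metis abs_minus_cancel abs_mult abs_of_pos)
  also have "\<dots> \<le> (LINT x:K|lebesgue. \<bar>f x - c\<bar>)"
    using set_integral_norm_bound[OF set_integral_diff(1)[OF f cK]] by simp
  finally have 1: "\<bar>c - A\<bar> * measure lebesgue K \<le> e * measure lebesgue K" using c by linarith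
  have "(LINT x:K|lebesgue. \<bar>f x - A\<bar>) \<le> (LINT x:K|lebesgue. \<bar>f x - c\<bar> + \<bar>c - A\<bar>)"
    by (rule set_integral_mono[OF i set_integral_add(1)[OF i cK]]) linarith
  also have "\<dots> = (LINT x:K|lebesgue. \<bar>f x - c\<bar>) + \<bar>c - A\<bar> * measure lebesgue K"
    by (simp add: set_integral_add(2)[OF i cK] set_integral_const_lmeasurable[OF K(1)])
  also have "\<dots> \<le> 2 * e * measure lebesgue K" using 1 c by linarith
  finally show ?thesis unfolding mean_osc_def A_def[symmetric] using K by (simp add: divide_le_eq)
qed

text \<open>With the constant 0 the oscillation is at most the average of |g|, and the interval has
  length at least q / 8. This turns convergence in mean into oscillation bounds on long
  intervals.\<close>

lemma near_const_large_interval: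
  fixes g :: "real \<Rightarrow> real"
  assumes g: "set_integrable lebesgue {0<..<L} g" and ab: "0 \<le> a" "b \<le> L" "q \<le> 8 * (b - a)" and q: "q > 0"
  shows "near_const (8 / q * (LINT s:{0<..<L}|lebesgue. \<bar>g s\<bar>)) {a<..<b} g"
proof -
  let ?I = "LINT s:{0<..<L}|lebesgue. \<bar>g s\<bar>"
  have I: "0 \<le> ?I" unfolding set_lebesgue_integral_def by (intro integral_nonneg_AE) auto
  have sub: "{a<..<b} \<subseteq> {0<..<L}" using ab by auto
  have "(LINT s:{a<..<b}|lebesgue. \<bar>g s - 0\<bar>) \<le> ?I"
    using set_integral_mono_set[OF set_integrable_abs[OF g], of "{a<..<b}"] sub by simp
  also have "?I = 8 / q * ?I * (q / 8)" using q by simp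
  also have "\<dots> \<le> 8 / q * ?I * measure lebesgue {a<..<b}"
    using ab q I by (intro mult_left_mono) auto
  finally show ?thesis unfolding near_const_def by blast
qed

text \<open>\<open>q\<close> is the measure of a dyadic cube at a level fine enough to bring it
  below \<delta>. It is chosen before \<open>f\<close>, so that a function and its approximations
  share one scale.\<close>

lemma decr_rearr_near_const:
  fixes Q :: "'a::euclidean_space set"
  assumes Q: "is_cube Q" and \<delta>: "\<delta> > 0"
  obtains q where "q > 0"
    "\<And>f e a b. set_integrable lebesgue Q f \<Longrightarrow>
       (\<And>K. K \<in> subcubes Q \<Longrightarrow> measure lebesgue K \<le> \<delta> \<Longrightarrow> near_const e K f) \<Longrightarrow>
       0 \<le> a \<Longrightarrow> a < b \<Longrightarrow> b \<le> measure lebesgue Q \<Longrightarrow> 8 * (b - a) \<le> q \<Longrightarrow>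
       near_const (2 ^ (DIM('a) + 4) * e) {a<..<b} (decr_rearr Q f)"
proof -
  obtain D r where Dfin: "\<And>m. finite (D m)" and Ddis: "\<And>m. disjoint (D m)"
    and Dneg: "\<And>m. negligible (Q - \<Union>(D m))" and Dsub: "\<And>m K. K \<in> D m \<Longrightarrow> K \<in> subcubes Q"
    and Dbox: "\<And>m K. K \<in> D m \<Longrightarrow> \<exists>y. K = box y (y + (r / 2 ^ m) *\<^sub>R One)"
    and r: "(r::real) > 0"
    by (rule dyadic_grid[OF Q]) (rule that; (assumption | blast))
  have "(\<lambda>m. r / 2 ^ m) \<longlonglongrightarrow> 0" by real_asymp
  from tendsto_power[OF this, of "DIM('a)"] have "(\<lambda>m. (r / 2 ^ m) ^ DIM('a)) \<longlonglongrightarrow> 0" by (simp add: zero_power)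
  then have "\<forall>\<^sub>F m in sequentially. (r / 2 ^ m) ^ DIM('a) < \<delta>"
    using \<delta> by (rule order_tendstoD(2))
  then obtain m where m: "(r / 2 ^ m) ^ DIM('a) < \<delta>" by (auto simp: eventually_sequentially)
  note Qm = is_cube_lmeasurable[OF Q]
  show thesis
  proof (rule that[of "(r / 2 ^ m) ^ DIM('a)"])
    fix f :: "'a \<Rightarrow> real" and e a b
    assume f: "set_integrable lebesgue Q f"
      and near: "\<And>K. K \<in> subcubes Q \<Longrightarrow> measure lebesgue K \<le> \<delta> \<Longrightarrow> near_const e K f"
      and ab: "0 \<le> a" "a < b" "b \<le> measure lebesgue Q" "8 * (b - a) \<le> (r / 2 ^ m) ^ DIM('a)"
    show "near_const (2 ^ (DIM('a) + 4) * e) {a<..<b} (decr_rearr Q f)"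
    proof (rule equidistributed_osc[OF Q refl set_integrable_abs[OF f] equidistributed_decr_rearr[OF Qm f]
          _ Dfin[of m] Ddis Dneg _ _ _ _ ab])
      show "decr_rearr Q f t \<le> decr_rearr Q f s" if "0 < s" "s \<le> t" for s t
        by (rule decr_rearr_antimono[OF Qm f that])
      show "near_const e K (\<lambda>x. \<bar>f x\<bar>)" if K: "K \<in> subcubes Q" "measure lebesgue K \<le> (r / 2 ^ m) ^ DIM('a)" for K
      proof -
        have "K \<in> lmeasurable" "K \<subseteq> Q" using K is_cube_lmeasurable[of K] by (auto simp: subcubes_def)
        then show ?thesis using K(2) m by (intro near_const_abs near[OF K(1)] set_integrable_subset[OF f]) auto
      qed
    qed (use Dsub Dbox r in auto)
  qed (use r in simp)
qed

lemma subcubes_interval: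
  assumes "J \<in> subcubes {0<..<L::real}"
  obtains a b where "J = {a<..<b}" "0 \<le> a" "a < b" "b \<le> L"
proof -
  obtain a b where ab: "a < b" "J = {a<..<b}" "J \<subseteq> {0<..<L}" using assms by (auto simp: subcubes_def is_cube_real)
  then have "0 \<le> a" "b \<le> L" by (simp_all add: greaterThanLessThan_subseteq_greaterThanLessThan)
  then show thesis using ab that by blast
qed

lemma bmo_seminorm_le:
  assumes "0 \<le> B" "\<And>K. K \<in> subcubes Q \<Longrightarrow> mean_osc f K \<le> B"
  shows "bmo_seminorm Q f \<le> ennreal B"
  unfolding bmo_seminorm_def using assms by (intro SUP_least ennreal_leI) auto

lemma mean_osc_le_bmo: "K \<in> subcubes Q \<Longrightarrow> ennreal (mean_osc f K) \<le> bmo_seminorm Q f"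
  unfolding bmo_seminorm_def by (rule SUP_upper)

text \<open>With \<delta> the measure of \<open>Q\<close> and \<open>e\<close> the seminorm of
  \<open>f\<close>, the local estimate handles intervals up to a fixed length, and the integral of
  the rearrangement bounds the oscillation on longer ones.\<close>

lemma decr_rearr_BMO:
  fixes Q :: "'a::euclidean_space set"
  assumes Q: "is_cube Q" and f: "f \<in> BMO Q"
  shows "decr_rearr Q f \<in> BMO {0<..<measure lebesgue Q}"
proof -
  let ?L = "measure lebesgue Q" and ?g = "decr_rearr Q f"
  note Qm = is_cube_lmeasurable[OF Q]
  have L: "?L > 0" by (rule is_cube_measure_pos[OF Q])
  have fi: "set_integrable lebesgue Q f" using f Q by (auto simp: BMO_def subcubes_def)
  note gi = decr_rearr_integrable[OF Qm fi]
  define N where "N = enn2real (bmo_seminorm Q f)"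
  have near: "near_const N K f" if "K \<in> subcubes Q" for K
  proof -
    have "ennreal (mean_osc f K) \<le> ennreal N"
      using mean_osc_le_bmo[OF that, of f] f by (simp add: N_def BMO_def)
    then have "mean_osc f K \<le> N" by (simp add: N_def)
    then show ?thesis using that is_cube_measure_pos[of K]
      by (intro near_const_mono[OF near_const_mean_osc]) (auto simp: subcubes_def)
  qed
  obtain q where q: "q > 0" and small: "\<And>f e a b. set_integrable lebesgue Q f \<Longrightarrow>
       (\<And>K. K \<in> subcubes Q \<Longrightarrow> measure lebesgue K \<le> ?L \<Longrightarrow> near_const e K f) \<Longrightarrow>
       0 \<le> a \<Longrightarrow> a < b \<Longrightarrow> b \<le> ?L \<Longrightarrow> 8 * (b - a) \<le> q \<Longrightarrow>
       near_const (2 ^ (DIM('a) + 4) * e) {a<..<b} (decr_rearr Q f)"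
    by (rule decr_rearr_near_const[OF Q L]) blast
  define B where "B = max (2 ^ (DIM('a) + 4) * N) (8 / q * (LINT s:{0<..<?L}|lebesgue. \<bar>?g s\<bar>))"
  have sub: "set_integrable lebesgue J ?g" if "J \<in> subcubes {0<..<?L}" for J
    using that is_cube_lmeasurable[of J] by (intro set_integrable_subset[OF gi]) (auto simp: subcubes_def)
  have osc: "mean_osc ?g J \<le> 2 * B" if J: "J \<in> subcubes {0<..<?L}" for J
  proof -
    obtain a b where ab: "J = {a<..<b}" "0 \<le> a" "a < b" "b \<le> ?L" using J by (rule subcubes_interval)
    have "near_const B J ?g"
    proof (cases "8 * (b - a) \<le> q")
      case True
      show ?thesis unfolding ab(1)
        by (rule near_const_mono[OF small[OF fi near ab(2-4) True]]) (auto simp: B_def)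
    next
      case False
      show ?thesis unfolding ab(1)
        by (rule near_const_mono[OF near_const_large_interval[OF gi ab(2,4) _ q]]) (use False in \<open>auto simp: B_def\<close>)
    qed
    then show ?thesis using sub[OF J] ab by (intro mean_osc_le_near_const) auto
  qed
  have "0 \<le> B" unfolding B_def by (simp add: N_def le_max_iff_disj)
  then have "bmo_seminorm {0<..<?L} ?g \<le> ennreal (2 * B)" using osc by (intro bmo_seminorm_le) auto
  also have "\<dots> < \<infinity>" by simp
  finally show ?thesis using sub by (simp add: BMO_def)
qed

text \<open>The seminorm ignores additive constants. Together with convergence of the means, this
  bound turns convergence in BMO into convergence in the \<open>L\<^sup>1\<close> norm.\<close>

lemma L1_le_mean_osc:
  assumes Q: "Q \<in> lmeasurable" "measure lebesgue Q > 0" and h: "set_integrable lebesgue Q h"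
  shows "(LINT x:Q|lebesgue. \<bar>h x\<bar>) \<le> measure lebesgue Q * (mean_osc h Q + \<bar>avg h Q\<bar>)"
proof -
  note cQ = set_integrable_const_lmeasurable[OF Q(1)]
  note i = set_integrable_abs[OF set_integral_diff(1)[OF h cQ]]
  have "(LINT x:Q|lebesgue. \<bar>h x\<bar>) \<le> (LINT x:Q|lebesgue. \<bar>h x - avg h Q\<bar> + \<bar>avg h Q\<bar>)"
    by (rule set_integral_mono[OF set_integrable_abs[OF h] set_integral_add(1)[OF i cQ]]) linarith
  also have "\<dots> = (LINT x:Q|lebesgue. \<bar>h x - avg h Q\<bar>) + \<bar>avg h Q\<bar> * measure lebesgue Q"
    by (simp add: set_integral_add(2)[OF i cQ] set_integral_const_lmeasurable[OF Q(1)])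
  also have "\<dots> = measure lebesgue Q * (mean_osc h Q + \<bar>avg h Q\<bar>)"
    using Q by (simp add: mean_osc_def algebra_simps)
  finally show ?thesis .
qed

theorem theorem2:
  fixes Q0 :: "(real ^ 'n) set"
    and F :: "nat \<Rightarrow> real ^ 'n \<Rightarrow> real"
    and f :: "real ^ 'n \<Rightarrow> real"
  assumes "is_cube Q0"
    and "\<And>k. F k \<in> BMO Q0"
    and "f \<in> VMO Q0"
    and "(\<lambda>k. bmo_seminorm Q0 (\<lambda>x. F k x - f x)) \<longlonglongrightarrow> 0"
    and "(\<lambda>k. avg (F k) Q0) \<longlonglongrightarrow> avg f Q0"
  shows "(\<forall>k. decr_rearr Q0 (F k) \<in> BMO {0<..<measure lebesgue Q0}) \<and>
    decr_rearr Q0 f \<in> BMO {0<..<measure lebesgue Q0} \<and>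
    (\<lambda>k. bmo_seminorm {0<..<measure lebesgue Q0}
       (\<lambda>s. decr_rearr Q0 (F k) s - decr_rearr Q0 f s)) \<longlonglongrightarrow> 0"
proof (intro conjI allI)
  note Q = assms(1) and VMO = assms(3)
  \<comment> \<open>The two membership claims guarantee that the integrals in the seminorm of the
    difference are integrals of integrable functions.\<close>
  show "decr_rearr Q0 (F k) \<in> BMO {0<..<measure lebesgue Q0}" for k by (rule decr_rearr_BMO[OF Q assms(2)])
  have fB: "f \<in> BMO Q0" using VMO by (simp add: VMO_def)
  then show "decr_rearr Q0 f \<in> BMO {0<..<measure lebesgue Q0}" by (rule decr_rearr_BMO[OF Q])
  let ?L = "measure lebesgue Q0" and ?G = "\<lambda>k. decr_rearr Q0 (F k)" and ?g = "decr_rearr Q0 f"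
  note Qm = is_cube_lmeasurable[OF Q]
  have L: "?L > 0" by (rule is_cube_measure_pos[OF Q])
  have QQ: "Q0 \<in> subcubes Q0" using Q by (simp add: subcubes_def)
  have fi: "set_integrable lebesgue K f" "set_integrable lebesgue K (F k)"
      "set_integrable lebesgue K (\<lambda>x. F k x - f x)" if "K \<in> subcubes Q0" for K k
    using fB assms(2) that by (auto simp: BMO_def)
  note gi = decr_rearr_integrable[OF Qm fi(1)[OF QQ]] and Gi = decr_rearr_integrable[OF Qm fi(2)[OF QQ]]
  have cube: "K \<in> lmeasurable" "measure lebesgue K > 0" if "K \<in> subcubes Q0" for K
    using that is_cube_lmeasurable is_cube_measure_pos by (auto simp: subcubes_def)
  define C :: real where "C = 2 ^ (DIM(real ^ 'n) + 4)"
  have C: "C > 0" by (simp add: C_def)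
  have main: "\<forall>\<^sub>F k in sequentially. bmo_seminorm {0<..<?L} (\<lambda>s. ?G k s - ?g s) \<le> ennreal \<eta>" if \<eta>: "\<eta> > 0" for \<eta> :: real
  proof -
    \<comment> \<open>On short intervals the two rearrangements contribute C * (2 * \<epsilon>) and
      C * \<epsilon>, in sum \<eta> / 2; passing to \<open>mean_osc\<close> doubles this to
      \<eta>.\<close>
    define \<epsilon> where "\<epsilon> = \<eta> / (6 * C)"
    have \<epsilon>: "\<epsilon> > 0" using \<eta> C by (simp add: \<epsilon>_def)
    have "\<forall>\<^sub>F \<delta> in at_right 0. (SUP K\<in>{K \<in> subcubes Q0. measure lebesgue K \<le> \<delta>}. ennreal (mean_osc f K)) < ennreal \<epsilon>"
      using VMO \<epsilon> unfolding VMO_def by (intro order_tendstoD(2)[of _ 0]) auto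
    then obtain \<delta>0 where "\<delta>0 > 0" and \<delta>0: "\<And>\<delta>. 0 < \<delta> \<Longrightarrow> \<delta> < \<delta>0 \<Longrightarrow>
        (SUP K\<in>{K \<in> subcubes Q0. measure lebesgue K \<le> \<delta>}. ennreal (mean_osc f K)) < ennreal \<epsilon>"
      unfolding eventually_at_right_field by blast
    define \<delta> where "\<delta> = \<delta>0 / 2"
    have \<delta>: "\<delta> > 0" using \<open>\<delta>0 > 0\<close> by (simp add: \<delta>_def)
    have f_osc: "near_const \<epsilon> K f" if K: "K \<in> subcubes Q0" "measure lebesgue K \<le> \<delta>" for K
    proof -
      have "ennreal (mean_osc f K) \<le> (SUP K\<in>{K \<in> subcubes Q0. measure lebesgue K \<le> \<delta>}. ennreal (mean_osc f K))"
        using K by (intro SUP_upper) auto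
      also have "\<dots> < ennreal \<epsilon>" using \<delta>0[of \<delta>] \<delta> by (simp add: \<delta>_def)
      finally have "mean_osc f K \<le> \<epsilon>" using mean_osc_nonneg[of f K] by (simp add: ennreal_less_iff)
      then show ?thesis using cube(2)[OF K(1)] by (intro near_const_mono[OF near_const_mean_osc])
    qed
    obtain q where q: "q > 0" and small: "\<And>f e a b. set_integrable lebesgue Q0 f \<Longrightarrow>
         (\<And>K. K \<in> subcubes Q0 \<Longrightarrow> measure lebesgue K \<le> \<delta> \<Longrightarrow> near_const e K f) \<Longrightarrow>
         0 \<le> a \<Longrightarrow> a < b \<Longrightarrow> b \<le> ?L \<Longrightarrow> 8 * (b - a) \<le> q \<Longrightarrow>
         near_const (C * e) {a<..<b} (decr_rearr Q0 f)"
      unfolding C_def by (rule decr_rearr_near_const[OF Q \<delta>]) blast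
    \<comment> \<open>The second entry serves long intervals: the \<open>L\<^sup>1\<close> norm of F
      k - f is then at most 2 * \<epsilon>1 times the measure of \<open>Q0\<close>, so at most
      \<eta> * q / 16, and the factor 8 / q gives \<eta> / 2.\<close>
    define \<epsilon>1 where "\<epsilon>1 = min \<epsilon> (\<eta> * q / (32 * ?L))"
    have \<epsilon>1: "\<epsilon>1 > 0" using \<epsilon> \<eta> q L by (simp add: \<epsilon>1_def)
    have "\<forall>\<^sub>F k in sequentially. bmo_seminorm Q0 (\<lambda>x. F k x - f x) < ennreal \<epsilon>1"
      using assms(4) \<epsilon>1 by (intro order_tendstoD(2)[of _ 0]) auto
    moreover have "\<forall>\<^sub>F k in sequentially. dist (avg (F k) Q0) (avg f Q0) < \<epsilon>1"
      using assms(5) \<epsilon>1 by (rule tendstoD)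
    ultimately show ?thesis
    proof eventually_elim
      case (elim k)
      let ?h = "\<lambda>x. F k x - f x"
      have h_osc: "mean_osc ?h K \<le> \<epsilon>1" if "K \<in> subcubes Q0" for K
        using le_less_trans[OF mean_osc_le_bmo[OF that] elim(1)] mean_osc_nonneg[of ?h K] by (simp add: ennreal_less_iff)
      \<comment> \<open>Writing \<open>F k\<close> as \<open>f\<close> plus a difference of small
        seminorm carries the smallness at scale \<delta> over from \<open>f\<close>.\<close>
      have F_osc: "near_const (2 * \<epsilon>) K (F k)" if K: "K \<in> subcubes Q0" "measure lebesgue K \<le> \<delta>" for K
      proof -
        have "near_const \<epsilon> K ?h"
          using h_osc[OF K(1)] cube(2)[OF K(1)] by (intro near_const_mono[OF near_const_mean_osc]) (auto simp: \<epsilon>1_def)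
        then have "near_const (\<epsilon> + \<epsilon>) K (\<lambda>x. ?h x + f x)"
          by (intro near_const_add cube fi K f_osc)
        then show ?thesis by simp
      qed
      have "avg ?h Q0 = avg (F k) Q0 - avg f Q0"
        unfolding avg_def by (simp add: set_integral_diff(2)[OF fi(2,1)[OF QQ]] diff_divide_distrib)
      then have "\<bar>avg ?h Q0\<bar> \<le> \<epsilon>1" using elim(2) by (simp add: dist_real_def)
      then have "mean_osc ?h Q0 + \<bar>avg ?h Q0\<bar> \<le> 2 * \<epsilon>1" using h_osc[OF QQ] by linarith
      then have "?L * (mean_osc ?h Q0 + \<bar>avg ?h Q0\<bar>) \<le> ?L * (2 * \<epsilon>1)" using L by (intro mult_left_mono) auto
      also have "\<dots> \<le> ?L * (2 * (\<eta> * q / (32 * ?L)))" using L by (intro mult_left_mono) (auto simp: \<epsilon>1_def)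
      also have "\<dots> = \<eta> * q / 16" using L by simp
      finally have "(LINT s:{0<..<?L}|lebesgue. \<bar>?G k s - ?g s\<bar>) \<le> \<eta> * q / 16"
        using decr_rearr_L1_contraction[OF Qm fi(2)[OF QQ, of k] fi(1)[OF QQ]] L1_le_mean_osc[OF Qm L fi(3)[OF QQ, of k]]
        by linarith
      then have "8 / q * (LINT s:{0<..<?L}|lebesgue. \<bar>?G k s - ?g s\<bar>) \<le> 8 / q * (\<eta> * q / 16)"
        using q by (intro mult_left_mono) auto
      also have "\<dots> = \<eta> / 2" using q by simp
      finally have L1: "8 / q * (LINT s:{0<..<?L}|lebesgue. \<bar>?G k s - ?g s\<bar>) \<le> \<eta> / 2" .
      show ?case
      proof (rule bmo_seminorm_le)
        fix J assume J: "J \<in> subcubes {0<..<?L}"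
        obtain a b where ab: "J = {a<..<b}" "0 \<le> a" "a < b" "b \<le> ?L" using J by (rule subcubes_interval)
        have sub: "set_integrable lebesgue J ?g" "set_integrable lebesgue J (?G k)"
          using ab by (auto intro!: set_integrable_subset[OF gi] set_integrable_subset[OF Gi])
        have Jm: "J \<in> lmeasurable" by (simp add: ab(1))
        have "near_const (\<eta> / 2) J (\<lambda>s. ?G k s - ?g s)"
        proof (cases "8 * (b - a) \<le> q")
          case True
          have "near_const (C * \<epsilon>) J ?g" "near_const (C * (2 * \<epsilon>)) J (?G k)"
            unfolding ab(1) by (rule small[OF fi(1)[OF QQ] f_osc ab(2-4) True]; assumption)
              (rule small[OF fi(2)[OF QQ] F_osc ab(2-4) True]; assumption)
          then have "near_const (C * (2 * \<epsilon>) + C * \<epsilon>) J (\<lambda>s. ?G k s + - ?g s)"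
            using sub by (intro near_const_add Jm near_const_uminus) (auto simp: set_integrable_def)
          moreover have "C * (2 * \<epsilon>) + C * \<epsilon> = \<eta> / 2" using C by (simp add: \<epsilon>_def field_simps)
          ultimately show ?thesis by simp
        next
          case False
          show ?thesis unfolding ab(1)
            by (rule near_const_mono[OF near_const_large_interval[OF set_integral_diff(1)[OF Gi gi] ab(2,4) _ q] L1])
              (use False in simp)
        qed
        then have "mean_osc (\<lambda>s. ?G k s - ?g s) J \<le> 2 * (\<eta> / 2)"
          using sub ab by (intro mean_osc_le_near_const Jm) auto
        then show "mean_osc (\<lambda>s. ?G k s - ?g s) J \<le> \<eta>" by simp
      qed (use \<eta> in simp)
    qed
  qed
  show "(\<lambda>k. bmo_seminorm {0<..<?L} (\<lambda>s. ?G k s - ?g s)) \<longlonglongrightarrow> 0"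
  proof (rule order_tendstoI)
    fix c :: ennreal assume "0 < c"
    \<comment> \<open>\<open>c\<close> may be infinite, so a finite level strictly below it is
      chosen.\<close>
    then obtain d where d: "0 < d" "d < c" using dense by blast
    then obtain \<eta> where \<eta>: "d = ennreal \<eta>" "\<eta> > 0" by (cases d) (auto simp: less_top[symmetric])
    show "\<forall>\<^sub>F k in sequentially. bmo_seminorm {0<..<?L} (\<lambda>s. ?G k s - ?g s) < c"
      using main[OF \<eta>(2)] by (rule eventually_mono) (use d \<eta> in auto)
  qed simp
qed

end
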